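(* Let $p\in[\frac12,1)$ and let $\{X_n\}_{n=0}^\infty$ be a random walk in the deterministic "have your cookie and eat it" environment with $\omega(x)=p$ for all $x\in\mathbb{Z}$. If $p<\frac34$, then the process is non-ballistic: $\lim_{n\to\infty}\frac{X_n}{n}=0$ a.s. If $p>\frac34$, then the process is ballistic: $\lim_{n\to\infty}\frac{X_n}{n}$ exists and is positive a.s. In fact, for $p>\frac34$, almost surely $$\lim_{n\to\infty}\frac{X_n}{n}\ge 4p-3,\quad\text{with equality if } \tfrac{10}{11}\le p<1.$$
   Context: Random walk in a "have your cookie and eat it" environment: given $\omega=\{\omega(x)\}_{x\in\mathbb{Z}}$ with $\omega(x)\in[\frac12,1)$, the process $\{X_n\}_{n\ge0}$ is the nearest-neighbor process on $\mathbb{Z}$ (each step is $\pm1$), started from a deterministic point, such that, conditionally on $X_0,\dots,X_n$, the probability that $X_{n+1}=X_n+1$ equals $\omega(X_n)$ if the process has not previously jumped left from the site $X_n$ (i.e. there is no $k<n$ with $X_k=X_n$ and $X_{k+1}=X_n-1$), and equals $\frac12$ otherwise; with the complementary probability $X_{n+1}=X_n-1$. *)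

theory Defs
  imports "HOL-Probability.Probability"
begin

definition jumped_left_before :: "(nat \<Rightarrow> int) \<Rightarrow> nat \<Rightarrow> bool" where
  "jumped_left_before x n \<longleftrightarrow> (\<exists>k<n. x k = x n \<and> x (Suc k) = x n - 1)"

definition right_prob :: "(int \<Rightarrow> real) \<Rightarrow> (nat \<Rightarrow> int) \<Rightarrow> nat \<Rightarrow> real" where
  "right_prob \<omega> x n = (if jumped_left_before x n then 1/2 else \<omega> (x n))"

(* The walk takes discrete values, so the conditional law of X (n+1) given X 0, ..., X n is
   prescribed by elementary conditioning on each history h 0, ..., h n of positive probability
   (cond_prob is a junk value on null histories; only h 0, ..., h n matter). *)
locale cookie_random_walk = prob_space M for M :: "'a measure" +
  fixes \<omega> :: "int \<Rightarrow> real" and x0 :: int and X :: "nat \<Rightarrow> 'a \<Rightarrow> int"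
  assumes env: "\<omega> x \<in> {1/2..<1}"
    and rv: "random_variable (count_space UNIV) (X n)"
    and start: "AE s in M. X 0 s = x0"
    and step_right:
      "\<P>(s in M. \<forall>i\<le>n. X i s = h i) > 0 \<Longrightarrow>
        \<P>(s in M. X (Suc n) s = h n + 1 \<bar> \<forall>i\<le>n. X i s = h i) = right_prob \<omega> h n"
    and step_left:
      "\<P>(s in M. \<forall>i\<le>n. X i s = h i) > 0 \<Longrightarrow>
        \<P>(s in M. X (Suc n) s = h n - 1 \<bar> \<forall>i\<le>n. X i s = h i) = 1 - right_prob \<omega> h n"

end

(* The position X n is read off the hitting times of the levels x0 + n.  When the level x0 + n is
   first hit, the number of left jumps from a site depends on the past only through the number of
   left jumps from its right neighbour, so the hitting time is n + 2 S in law, where S is the sum of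
   a Markov chain Z explored from right to left.  The identity in law comes from a martingale:
   revealing one step of the walk averages the conditional law of the whole chain given the jumps
   made so far.  With mu = p / (1 - p) and f z = z^2 + (2 mu - 1) z, one step of the chain satisfies
   E f(Z') = f z + 4 - 2 (mu - 3) z exactly, which forces the mean 2 / (mu - 3) of Z and hence the
   speed 4 p - 3.  Z has barely more than a first moment when p is close to 3/4, but a moment of
   order 2 + delta growing linearly yields polynomial rates.  The lower tail of S comes from
   comparison with sums of independent blocks, the upper tail from the lower tail together with the
   exact mean.  Borel-Cantelli along polynomial levels finishes the ballistic case; for p < 3/4,
   monotonicity in p bounds the speed by 4 q - 3 for every q > 3/4. *)

theory Submission
  imports Defs "HOL-Real_Asymp.Real_Asymp"
begin

section \<open>The exploration chain of left jumps\<close>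

text \<open>Forwards in time the walk depends on its whole past through the used sites; read from
  right to left at a hitting time, the same data form a Markov chain. The identity in law is proved
  up to a finite horizon \<open>T\<close>, which needs only finitely many sites. With r right jumps
  due, a fresh site makes r - (\<mu> - 1)(1 - p^r) left jumps on average. The second moment also has
  a p^r term, and the coefficient 2 \<mu> - 1 in f is the one for which these terms cancel. Right of
  the start every site owes one extra right jump and the drift of f is 4 - (2 \<mu> - 6) z; left of
  it the drift is -(2 \<mu> - 4) z, so all those sites together cost no more than the order of f at
  the start. The exact identity gives the mean of S up to a multiple of E f(Z_n), and the crude
  bound 4 n for it has the order of S itself; the moment of order 2 + \<delta> improves it to n^(1 -
  \<delta>). The second moment bound for S, of order n^3, is too weak for Chebyshev over the whole
  distance, so the chain is cut into short blocks, each restarted at 0. Restarting only lowers S,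
  hence a single tail results.\<close>

abbreviation fair_lefts :: "nat \<Rightarrow> nat pmf" where
  "fair_lefts r \<equiv> neg_binomial_pmf r (1/2)"

text \<open>The left branch keeps \<open>Suc r\<close>: the failed attempt uses up no right jump,
  and from then on the site is fair.\<close>

primrec cookie_lefts :: "real \<Rightarrow> nat \<Rightarrow> nat pmf" where
  "cookie_lefts p 0 = return_pmf 0"
| "cookie_lefts p (Suc r) = bind_pmf (bernoulli_pmf p)
     (\<lambda>b. if b then cookie_lefts p r else map_pmf Suc (fair_lefts (Suc r)))"

text \<open>Law of the final number of left jumps from a site when \<open>l\<close> of them have been made and
  \<open>r\<close> right jumps are still to come; the site is fresh iff \<open>l = 0\<close>.\<close>

definition site_lefts :: "real \<Rightarrow> nat \<Rightarrow> nat \<Rightarrow> nat pmf" where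
  "site_lefts p l r = map_pmf ((+) l) (if l = 0 then cookie_lefts p r else fair_lefts r)"

lemma site_lefts_0: "site_lefts p l 0 = return_pmf l"
  by (simp add: site_lefts_def)

lemma site_lefts_fresh: "site_lefts p 0 r = cookie_lefts p r"
proof -
  have [simp]: "(+) (0 :: nat) = id" by auto
  show ?thesis by (simp add: site_lefts_def)
qed

lemma site_lefts_ge: "z \<in> set_pmf (site_lefts p l r) \<Longrightarrow> l \<le> z"
  by (auto simp: site_lefts_def)

text \<open>Condition on the next jump from the site. Once \<open>l > 0\<close> this is the
  one-trial recursion of the negative binomial law.\<close>

lemma site_lefts_Suc:
  "site_lefts p l (Suc r) = bind_pmf (bernoulli_pmf (if l = 0 then p else 1/2))
     (\<lambda>b. if b then site_lefts p l r else site_lefts p (Suc l) (Suc r))"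
proof (cases "l = 0")
  case True
  have [simp]: "(+) (Suc 0) = Suc" "(+) (0 :: nat) = id" by auto
  show ?thesis using True by (simp add: site_lefts_def cong: if_cong)
next
  case False
  have [simp]: "(+) (Suc l) = (\<lambda>x. Suc (l + x))" by auto
  have "site_lefts p l (Suc r) = map_pmf ((+) l) (fair_lefts (Suc r))"
    using False by (simp add: site_lefts_def)
  also have "\<dots> = map_pmf ((+) l) (bind_pmf (bernoulli_pmf (1/2))
       (\<lambda>b. if b then fair_lefts r else map_pmf Suc (fair_lefts (Suc r))))"
    by (subst neg_binomial_pmf_unfold) auto
  also have "\<dots> = bind_pmf (bernoulli_pmf (1/2))
     (\<lambda>b. if b then site_lefts p l r else site_lefts p (Suc l) (Suc r))"
    unfolding map_bind_pmf
    by (intro bind_pmf_cong refl)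
       (use False in \<open>auto simp: site_lefts_def map_pmf_comp\<close>)
  finally show ?thesis using False by simp
qed

text \<open>Exploration of the sites \<open>b - 1, b - 2, \<dots>\<close> at the first visit to \<open>b\<close>, given that \<open>R\<close> right and
  \<open>L\<close> left jumps have already been made. A state is (left jumps from the last explored site, total).
  Every right jump from \<open>x\<close> but the last is undone by a left jump from \<open>x + 1\<close>; the extra one occurs
  only at the \<open>n\<close> sites between the starting point and \<open>b\<close>.\<close>

primrec hit_chain ::
  "real \<Rightarrow> nat \<Rightarrow> int \<Rightarrow> (int \<Rightarrow> nat) \<Rightarrow> (int \<Rightarrow> nat) \<Rightarrow> nat \<Rightarrow> (nat \<times> nat) pmf" where
  "hit_chain p n b R L 0 = return_pmf (0, 0)"
| "hit_chain p n b R L (Suc k) = bind_pmf (hit_chain p n b R L k)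
     (\<lambda>(z, s). map_pmf (\<lambda>z'. (z', s + z'))
       (site_lefts p (L (b - 1 - int k)) (z + of_bool (k < n) - R (b - 1 - int k))))"

lemma hit_chain_cong:
  assumes "\<And>x. b - int k \<le> x \<Longrightarrow> x < b \<Longrightarrow> R x = R' x \<and> L x = L' x"
  shows "hit_chain p n b R L k = hit_chain p n b R' L' k"
  using assms by (induction k) (auto intro!: bind_pmf_cong)

text \<open>The martingale property: only the law at the current site \<open>x\<close> is affected by the next step, and the
  assumption says that the walk still has to jump right from \<open>x\<close>.\<close>

lemma hit_chain_split:
  assumes "k < m"
    and "\<And>z s. (z, s) \<in> set_pmf (hit_chain p n b R L k) \<Longrightarrow> R (b - 1 - int k) < z + of_bool (k < n)"
  defines "x \<equiv> b - 1 - int k"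
  shows "hit_chain p n b R L m = bind_pmf (bernoulli_pmf (if L x = 0 then p else 1/2))
     (\<lambda>c. if c then hit_chain p n b (R(x := Suc (R x))) L m else hit_chain p n b R (L(x := Suc (L x))) m)"
  using assms(1)
proof (induction m)
  case 0
  then show ?case by simp
next
  case (Suc m)
  let ?B = "bernoulli_pmf (if L x = 0 then p else 1/2)"
  show ?case
  \<comment> \<open>Only the exploration step from \<open>k\<close> to \<open>Suc k\<close> reads
    \<open>R\<close> and \<open>L\<close> at \<open>x\<close>; later steps inherit the split by
    associativity.\<close>
  proof (cases "m = k")
    case True
    have R: "hit_chain p n b (R(x := Suc (R x))) L k = hit_chain p n b R L k"
      and L: "hit_chain p n b R (L(x := Suc (L x))) k = hit_chain p n b R L k"
      by (rule hit_chain_cong, simp add: x_def)+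
    have "hit_chain p n b R L (Suc m) = bind_pmf (hit_chain p n b R L k)
        (\<lambda>(z, s). bind_pmf ?B (\<lambda>c. if c 
           then map_pmf (\<lambda>z'. (z', s + z')) (site_lefts p (L x) (z + of_bool (k < n) - Suc (R x)))
           else map_pmf (\<lambda>z'. (z', s + z')) (site_lefts p (Suc (L x)) (z + of_bool (k < n) - R x))))"
      unfolding hit_chain.simps True x_def[symmetric]
    proof (intro bind_pmf_cong refl, safe)
      fix z s assume "(z, s) \<in> set_pmf (hit_chain p n b R L k)"
      then have r: "z + of_bool (k < n) - R x = Suc (z + of_bool (k < n) - Suc (R x))"
        using assms(2)[of z s] by (simp add: x_def)
      show "map_pmf (\<lambda>z'. (z', s + z')) (site_lefts p (L x) (z + of_bool (k < n) - R x)) =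
        bind_pmf ?B (\<lambda>c. if c 
           then map_pmf (\<lambda>z'. (z', s + z')) (site_lefts p (L x) (z + of_bool (k < n) - Suc (R x)))
           else map_pmf (\<lambda>z'. (z', s + z')) (site_lefts p (Suc (L x)) (z + of_bool (k < n) - R x)))"
        unfolding r site_lefts_Suc[of p "L x"] map_bind_pmf
        by (intro bind_pmf_cong refl) auto
    qed
    \<comment> \<open>The coin at \<open>x\<close> is independent of the sites explored before
      \<open>x\<close>, so it may be tossed first.\<close>
    also have "\<dots> = bind_pmf ?B (\<lambda>c. bind_pmf (hit_chain p n b R L k) (\<lambda>(z, s). if c 
           then map_pmf (\<lambda>z'. (z', s + z')) (site_lefts p (L x) (z + of_bool (k < n) - Suc (R x)))
           else map_pmf (\<lambda>z'. (z', s + z')) (site_lefts p (Suc (L x)) (z + of_bool (k < n) - R x))))"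
      by (subst bind_commute_pmf) (simp add: case_prod_unfold)
    also have "\<dots> = bind_pmf ?B
     (\<lambda>c. if c then hit_chain p n b (R(x := Suc (R x))) L (Suc m)
       else hit_chain p n b R (L(x := Suc (L x))) (Suc m))"
      unfolding True hit_chain.simps R L x_def[symmetric]
      by (intro bind_pmf_cong refl) auto
    finally show ?thesis .
  next
    case False
    with Suc.prems have "k < m" by simp
    then have ne: "b - 1 - int m \<noteq> x" by (simp add: x_def)
    show ?thesis
      unfolding hit_chain.simps Suc.IH[OF \<open>k < m\<close>] bind_assoc_pmf
      by (intro bind_pmf_cong refl) (use ne in auto)
  qed
qed

text \<open>Left jumps already made are kept by the exploration. The first bound excludes an early
  hit for a path that is already long; the second shows that the current site still owes a right
  jump.\<close>

lemma hit_chain_ge: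
  assumes "(z, s) \<in> set_pmf (hit_chain p n b R L k)"
  shows "(\<Sum>i<k. L (b - 1 - int i)) \<le> s" and "0 < k \<Longrightarrow> L (b - int k) \<le> z"
  using assms
proof (induction k arbitrary: z s)
  case (Suc k)
  { case 1
    then show ?case using Suc.IH(1) site_lefts_ge by fastforce }
  { case 2
    then show ?case using site_lefts_ge by (force simp: algebra_simps) }
qed auto

text \<open>When every site has made all its right jumps, the difference in \<open>hit_chain\<close>
  is 0, no coin is tossed and the chain merely reads off \<open>L\<close>.\<close>

lemma hit_chain_terminal:
  assumes "\<And>i. i < k \<Longrightarrow> R (b - 1 - int i) = L (b - int i) + of_bool (i < n)" "L b = 0"
  shows "hit_chain p n b R L k = return_pmf (L (b - int k), \<Sum>i<k. L (b - 1 - int i))"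
  using assms(1)
proof (induction k)
  case 0
  then show ?case by (simp add: assms(2))
next
  case (Suc k)
  have "hit_chain p n b R L k = return_pmf (L (b - int k), \<Sum>i<k. L (b - 1 - int i))"
    using Suc by simp
  moreover have "R (b - 1 - int k) = L (b - int k) + of_bool (k < n)"
    using Suc.prems by simp
  ultimately show ?case
    by (simp add: bind_return_pmf site_lefts_0 algebra_simps)
qed

section \<open>The walk on histories\<close>

text \<open>A history is the list of visited sites, most recent first.\<close>

fun right_jumps :: "int list \<Rightarrow> int \<Rightarrow> nat" where
  "right_jumps (y # x # xs) = (let f = right_jumps (x # xs) in if y = x + 1 then f(x := Suc (f x)) else f)"
| "right_jumps xs = (\<lambda>_. 0)"

fun left_jumps :: "int list \<Rightarrow> int \<Rightarrow> nat" where
  "left_jumps (y # x # xs) = (let f = left_jumps (x # xs) in if y = x - 1 then f(x := Suc (f x)) else f)"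
| "left_jumps xs = (\<lambda>_. 0)"

fun nn_path :: "int \<Rightarrow> int list \<Rightarrow> bool" where
  "nn_path a (y # x # xs) \<longleftrightarrow> (y = x + 1 \<or> y = x - 1) \<and> nn_path a (x # xs)"
| "nn_path a [x] \<longleftrightarrow> x = a"
| "nn_path a [] \<longleftrightarrow> False"

definition cookie_step :: "real \<Rightarrow> int list \<Rightarrow> int list pmf" where
  "cookie_step p xs = map_pmf (\<lambda>c. (if c then hd xs + 1 else hd xs - 1) # xs)
     (bernoulli_pmf (if left_jumps xs (hd xs) = 0 then p else 1/2))"

primrec cookie_walk :: "real \<Rightarrow> int \<Rightarrow> nat \<Rightarrow> int list pmf" where
  "cookie_walk p a 0 = return_pmf [a]"
| "cookie_walk p a (Suc t) = bind_pmf (cookie_walk p a t) (cookie_step p)"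

lemma cookie_walk_path:
  "xs \<in> set_pmf (cookie_walk p a t) \<Longrightarrow> nn_path a xs \<and> length xs = Suc t"
proof (induction t arbitrary: xs)
  case (Suc t)
  then obtain ys where ys: "ys \<in> set_pmf (cookie_walk p a t)" "xs \<in> set_pmf (cookie_step p ys)"
    by auto
  then have "nn_path a ys" "length ys = Suc t" using Suc.IH by auto
  then show ?case using ys(2) by (cases ys) (auto simp: cookie_step_def)
qed auto

text \<open>Crossings of the edge between \<open>x\<close> and \<open>x + 1\<close> alternate in
  direction, so their imbalance depends only on the end points of the path.\<close>

lemma nn_path_jumps_balance:
  "nn_path a xs \<Longrightarrow> int (right_jumps xs x) =
     int (left_jumps xs (x + 1)) + of_bool (a \<le> x \<and> x < hd xs) - of_bool (hd xs \<le> x \<and> x < a)"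
  by (induction a xs rule: nn_path.induct) (auto simp: Let_def split: if_splits)

lemma jumps_outside:
  "x \<notin> set xs \<Longrightarrow> right_jumps xs x = 0 \<and> left_jumps xs x = 0"
  by (induction xs rule: left_jumps.induct) (auto simp: Let_def)

lemma nn_path_dist: "nn_path a xs \<Longrightarrow> x \<in> set xs \<Longrightarrow> \<bar>x - a\<bar> < int (length xs)"
proof (induction a xs arbitrary: x rule: nn_path.induct)
  case (1 a y z xs)
  from 1 have "\<bar>z - a\<bar> < int (length (z # xs))" "nn_path a (z # xs)" by auto
  with 1 show ?case by (cases "x = y") fastforce+
qed auto

lemma nn_path_start: "nn_path a xs \<Longrightarrow> xs \<noteq> [] \<and> a \<in> set xs"
  by (induction a xs rule: nn_path.induct) auto

lemma nn_path_below: "nn_path a xs \<Longrightarrow> b \<notin> set xs \<Longrightarrow> a < b \<Longrightarrow> x \<in> set xs \<Longrightarrow> x < b"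
proof (induction a xs arbitrary: x rule: nn_path.induct)
  case (1 a y z xs)
  then have "z < b" "y \<noteq> b" "y = z + 1 \<or> y = z - 1" by auto
  then have "y < b" by linarith
  with 1 show ?case by (cases "x = y") auto
qed auto

text \<open>The number of steps is right plus left jumps, the displacement their difference;
  eliminating the right jumps leaves twice the left ones. The leading 1 counts the starting
  site.\<close>

lemma nn_path_length:
  assumes "nn_path a xs" "finite A" "\<And>x. x \<notin> A \<Longrightarrow> left_jumps xs x = 0"
  shows "int (length xs) = 1 + 2 * int (\<Sum>x\<in>A. left_jumps xs x) + hd xs - a"
  using assms(1,3)
proof (induction a xs rule: nn_path.induct)
  case (1 a y z xs)
  let ?f = "left_jumps (z # xs)"
  have f: "left_jumps (y # z # xs) = (if y = z - 1 then ?f(z := Suc (?f z)) else ?f)"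
    by (simp add: Let_def)
  have z: "\<And>x. x \<notin> A \<Longrightarrow> ?f x = 0" 
  proof -
    fix x assume "x \<notin> A"
    then have "left_jumps (y # z # xs) x = 0" by (rule "1.prems"(2))
    then show "?f x = 0" unfolding f by (auto split: if_splits)
  qed
  have IH: "int (length (z # xs)) = 1 + 2 * int (\<Sum>x\<in>A. ?f x) + z - a"
  proof -
    have "nn_path a (z # xs)" using "1.prems"(1) by simp
    from "1.IH"[OF this z] show ?thesis by simp
  qed
  show ?case
  proof (cases "y = z - 1")
    case True
    have "z \<in> A" 
    proof (rule ccontr)
      assume "z \<notin> A"
      then have "left_jumps (y # z # xs) z = 0" by (rule "1.prems"(2))
      then show False unfolding f using True by simp
    qed
    have "(\<Sum>x\<in>A. left_jumps (y # z # xs) x) = Suc (?f z) + (\<Sum>x\<in>A - {z}. ?f x)"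
      unfolding f if_P[OF True] sum.remove[OF assms(2) \<open>z \<in> A\<close>] by simp
    also have "\<dots> = Suc (\<Sum>x\<in>A. ?f x)" using \<open>z \<in> A\<close> assms(2) by (simp add: sum.remove)
    finally show ?thesis using IH True by simp
  next
    case False
    then have "y = z + 1" using "1.prems"(1) by simp
    then show ?thesis using IH False unfolding f by simp
  qed
qed auto

section \<open>The conditional law of the exploration given a finite history\<close>

lemma sum_sites_below: "(\<Sum>i<m. f (b - 1 - int i)) = (\<Sum>x\<in>{b - int m..<b}. f x)"
  by (rule sum.reindex_bij_witness[of _ "\<lambda>x. nat (b - 1 - x)" "\<lambda>i. b - 1 - int i"]) auto

context
  fixes p :: real and n m T :: nat and a b :: int
  assumes b: "b = a + int n" and n: "0 < n" and m: "n + T \<le> m"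
begin

abbreviation "path_chain xs \<equiv> hit_chain p n b (right_jumps xs) (left_jumps xs)"

text \<open>At the first hit all right jumps owed have been made, so the exploration is
  deterministic. The list \<open>b # xs\<close> describes \<open>length xs\<close> steps, so
  \<open>n + 2 * s\<close> is the hitting time.\<close>

lemma path_chain_hit:
  assumes "nn_path a (b # xs)" "b \<notin> set xs" "length xs \<le> T"
  shows "\<exists>z s. path_chain (b # xs) m = return_pmf (z, s) \<and> n + 2 * s = length xs"
proof -
  let ?xs = "b # xs"
  have "xs \<noteq> []" using assms(1) b n by (cases xs) auto
  then have xs: "nn_path a xs" using assms(1) by (cases xs) auto
  have below: "x < b" if "x \<in> set xs" for x
    using nn_path_below[OF xs assms(2)] that b n by simp
  have "left_jumps xs b = 0" using jumps_outside assms(2) by blast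
  then have Lb: "left_jumps ?xs b = 0"
    using assms(2) \<open>xs \<noteq> []\<close> by (cases xs) (auto simp: Let_def)
  \<comment> \<open>Within \<open>T\<close> steps the walk does not go below \<open>a - T\<close>,
    hence not below the \<open>m\<close> explored sites, as \<open>n + T \<le> m\<close>.\<close>
  have L0: "left_jumps ?xs x = 0" if "x \<notin> {b - int m..<b}" for x
  proof (cases "x \<in> set ?xs")
    case True
    with that below Lb have "x = b \<or> x < b - int m" by fastforce
    moreover have "\<bar>x - a\<bar> < int (length ?xs)" using nn_path_dist assms(1) True by blast
    ultimately show ?thesis using Lb b m assms(3) by auto
  qed (use jumps_outside in blast)
  have "right_jumps ?xs (b - 1 - int i) = left_jumps ?xs (b - int i) + of_bool (i < n)" for i
  proof -
    have "int (right_jumps ?xs (b - 1 - int i)) = int (left_jumps ?xs (b - int i) + of_bool (i < n))"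
      using nn_path_jumps_balance[OF assms(1), of "b - 1 - int i"] b by (simp add: algebra_simps)
    then show ?thesis by (simp only: of_nat_eq_iff)
  qed
  then have "path_chain ?xs m = return_pmf (left_jumps ?xs (b - int m), \<Sum>i<m. left_jumps ?xs (b - 1 - int i))"
    by (intro hit_chain_terminal Lb) auto
  moreover have "int (length ?xs) = 1 + 2 * int (\<Sum>x\<in>{b - int m..<b}. left_jumps ?xs x) + b - a"
    using nn_path_length[OF assms(1), of "{b - int m..<b}"] L0 by simp
  then have "n + 2 * (\<Sum>i<m. left_jumps ?xs (b - 1 - int i)) = length xs"
    unfolding sum_sites_below using b by (simp flip: of_nat_sum)
  ultimately show ?thesis by blast
qed

text \<open>A path of \<open>T\<close> steps without a hit is a list of length \<open>T + 1\<close>,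
  so the chain has \<open>T < n + 2 * s\<close> on its whole support.\<close>

lemma path_chain_long:
  assumes "nn_path a xs" "b \<notin> set xs" "length xs \<le> Suc T" "(z, s) \<in> set_pmf (path_chain xs m)"
  shows "length xs \<le> n + 2 * s"
proof -
  have L0: "left_jumps xs x = 0" if "x \<notin> {b - int m..<b}" for x
  proof (cases "x \<in> set xs")
    case True
    then have "x < b" using nn_path_below[OF assms(1,2)] b n by simp
    with that have "x < b - int m" by simp
    moreover have "\<bar>x - a\<bar> < int (length xs)" using nn_path_dist assms(1) True by blast
    ultimately show ?thesis using b m assms(3) by auto
  qed (use jumps_outside in blast)
  have "hd xs < b"
    using nn_path_below[OF assms(1,2), of "hd xs"] nn_path_start[OF assms(1)] b n by simp
  moreover have "int (length xs) = 1 + 2 * int (\<Sum>x\<in>{b - int m..<b}. left_jumps xs x) + hd xs - a"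
    using nn_path_length[OF assms(1), of "{b - int m..<b}"] L0 by simp
  moreover have "(\<Sum>x\<in>{b - int m..<b}. left_jumps xs x) \<le> s"
    using hit_chain_ge(1)[OF assms(4)] unfolding sum_sites_below .
  ultimately show ?thesis using b by linarith
qed

text \<open>\<open>hit_chain_split\<close> applies at the current site \<open>x\<close>: for a path
  ending at \<open>x\<close>, the edge balance leaves the right jumps from \<open>x\<close> one
  short of those due, even if no further left jump is made from \<open>x + 1\<close>.\<close>

lemma path_chain_step:
  assumes "nn_path a xs" "b \<notin> set xs" "length xs \<le> T"
  shows "path_chain xs m = bind_pmf (cookie_step p xs) (\<lambda>ys. path_chain ys m)"
proof -
  define x where "x = hd xs"
  obtain zs where zs: "xs = x # zs" using nn_path_start[OF assms(1)] by (cases xs) (auto simp: x_def)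
  have xb: "x < b"
    using nn_path_below[OF assms(1,2), of x] zs b n by simp
  have "\<bar>x - a\<bar> < int (length xs)" by (rule nn_path_dist[OF assms(1)]) (simp add: zs)
  define k where "k = nat (b - 1 - x)"
  have kx: "b - 1 - int k = x" using xb by (simp add: k_def)
  have "k < m" using \<open>\<bar>x - a\<bar> < _\<close> m assms(3) b xb unfolding k_def by linarith
  have kn: "k < n \<longleftrightarrow> a \<le> x" using b xb by (auto simp: k_def)
  have kb: "b - int k = x + 1" using kx by simp
  have step: "right_jumps xs x < z + of_bool (k < n)" if "(z, s) \<in> set_pmf (path_chain xs k)" for z s
  proof -
    have "left_jumps xs (x + 1) \<le> z"
    proof (cases "k = 0")
      case True
      then have "x + 1 = b" using kx by simp
      then show ?thesis using jumps_outside[OF assms(2)] by simp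
    next
      case False
      then show ?thesis using hit_chain_ge(2)[OF that] unfolding kb by simp
    qed
    then show ?thesis
      using nn_path_jumps_balance[OF assms(1), of x] unfolding kn x_def[symmetric] by auto
  qed
  have R: "right_jumps ((x + 1) # xs) = (right_jumps xs)(x := Suc (right_jumps xs x))"
    "left_jumps ((x + 1) # xs) = left_jumps xs"
    and L: "left_jumps ((x - 1) # xs) = (left_jumps xs)(x := Suc (left_jumps xs x))"
    "right_jumps ((x - 1) # xs) = right_jumps xs"
    by (auto simp: zs Let_def)
  show ?thesis
    unfolding cookie_step_def bind_map_pmf x_def[symmetric]
    using hit_chain_split[OF \<open>k < m\<close>, of p n b "right_jumps xs" "left_jumps xs"] step unfolding kx
    by (auto simp: R L intro!: bind_pmf_cong)
qed

text \<open>\<open>V\<close> is the conditional probability, given the history, that the explored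
  hitting time is at most \<open>T\<close>, frozen at 1 after a visit to \<open>b\<close>. Its mean
  is constant up to time \<open>T\<close>, when \<open>V\<close> has become the indicator of the
  hit.\<close>

lemma prob_walk_hits:
  "measure_pmf.prob (cookie_walk p a T) {xs. b \<in> set xs} =
   measure_pmf.prob (hit_chain p n b (\<lambda>_. 0) (\<lambda>_. 0) m) {w. n + 2 * snd w \<le> T}"
proof -
  let ?E = "{w. n + 2 * snd w \<le> T}"
  define V where "V xs = (if b \<in> set xs then 1 else emeasure (path_chain xs m) ?E)" for xs
  have step: "(\<integral>\<^sup>+ys. V ys \<partial>cookie_step p xs) = V xs" if xs: "nn_path a xs" "length xs \<le> T" for xs
  proof (cases "b \<in> set xs")
    case True
    then have "(\<integral>\<^sup>+ys. V ys \<partial>cookie_step p xs) = (\<integral>\<^sup>+ys. 1 \<partial>cookie_step p xs)"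
      by (intro nn_integral_cong_AE) (auto simp: V_def cookie_step_def AE_measure_pmf_iff)
    then show ?thesis using True by (simp add: V_def)
  next
    case False
    have "(\<integral>\<^sup>+ys. V ys \<partial>cookie_step p xs) = (\<integral>\<^sup>+ys. emeasure (path_chain ys m) ?E \<partial>cookie_step p xs)"
    proof (intro nn_integral_cong_AE, unfold AE_measure_pmf_iff, safe)
      fix ys assume "ys \<in> set_pmf (cookie_step p xs)"
      then obtain y where y: "ys = y # xs" "y = hd xs + 1 \<or> y = hd xs - 1" 
        by (auto simp: cookie_step_def split: if_splits)
      show "V ys = emeasure (path_chain ys m) ?E"
      proof (cases "y = b")
        case True
        have "nn_path a (b # xs)" using xs(1) y True by (cases xs) auto
        from path_chain_hit[OF this False xs(2)] obtain z s 
          where *: "path_chain (b # xs) m = return_pmf (z, s)" "n + 2 * s \<le> T" using xs(2) by auto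
        then show ?thesis unfolding V_def y True by (simp add: indicator_def)
      next
        case False
        then show ?thesis using \<open>b \<notin> set xs\<close> y by (auto simp: V_def)
      qed
    qed
    also have "\<dots> = emeasure (path_chain xs m) ?E"
      by (simp add: path_chain_step[OF xs(1) False xs(2)] emeasure_bind_pmf)
    finally show ?thesis using False by (simp add: V_def)
  qed
  have "(\<integral>\<^sup>+xs. V xs \<partial>cookie_walk p a t) = V [a]" if "t \<le> T" for t
    using that
  proof (induction t)
    case (Suc t)
    have "(\<integral>\<^sup>+xs. V xs \<partial>cookie_walk p a (Suc t)) = (\<integral>\<^sup>+xs. V xs \<partial>cookie_walk p a t)"
      unfolding cookie_walk.simps nn_integral_bind_pmf using Suc.prems
      by (intro nn_integral_cong_AE) (auto simp: AE_measure_pmf_iff intro!: step dest: cookie_walk_path)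
    then show ?case using Suc by simp
  qed simp
  then have "V [a] = (\<integral>\<^sup>+xs. V xs \<partial>cookie_walk p a T)" by simp
  also have "\<dots> = (\<integral>\<^sup>+xs. indicator {xs. b \<in> set xs} xs \<partial>cookie_walk p a T)"
  proof (intro nn_integral_cong_AE, unfold AE_measure_pmf_iff, safe)
    fix xs assume "xs \<in> set_pmf (cookie_walk p a T)"
    then have xs: "nn_path a xs" "length xs = Suc T" using cookie_walk_path by auto
    show "V xs = indicator {xs. b \<in> set xs} xs"
    proof (cases "b \<in> set xs")
      case False
      have "emeasure (path_chain xs m) ?E = emeasure (path_chain xs m) {}"
        using path_chain_long[OF xs(1) False] xs(2) 
        by (intro emeasure_eq_AE) (fastforce simp: AE_measure_pmf_iff)+
      then show ?thesis using False by (simp add: V_def)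
    qed (simp add: V_def)
  qed
  also have "\<dots> = emeasure (cookie_walk p a T) {xs. b \<in> set xs}" by simp
  finally show ?thesis
    using b n by (simp add: V_def measure_pmf.emeasure_eq_measure)
qed

end

section \<open>The given process as a walk on histories\<close>

primrec history :: "(nat \<Rightarrow> int) \<Rightarrow> nat \<Rightarrow> int list" where
  "history x 0 = [x 0]"
| "history x (Suc t) = x (Suc t) # history x t"

lemma hd_history: "hd (history x t) = x t"
  by (cases t) auto

lemma length_history: "length (history x t) = Suc t"
  by (induction t) auto

lemma set_history: "set (history x t) = x ` {..t}"
  by (induction t) (auto simp: atMost_Suc)

lemma history_eq_iff: "history x t = history y t \<longleftrightarrow> (\<forall>i\<le>t. x i = y i)"
  by (induction t) (auto simp: le_Suc_eq)

lemma ex_history: "length xs = Suc t \<Longrightarrow> \<exists>h. history h t = xs"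
proof (induction t arbitrary: xs)
  case 0
  then obtain x where "xs = [x]" by (auto simp: length_Suc_conv)
  then show ?case by (intro exI[of _ "\<lambda>_. x"]) simp
next
  case (Suc t)
  then obtain x ys where xs: "xs = x # ys" "length ys = Suc t" by (auto simp: length_Suc_conv)
  with Suc.IH obtain h where "history h t = ys" by auto
  moreover have "history (h(Suc t := x)) t = history h t" unfolding history_eq_iff by auto
  ultimately have "history (h(Suc t := x)) (Suc t) = xs" by (simp add: xs)
  then show ?case by blast
qed

lemma left_jumps_history:
  "left_jumps (history h t) y \<noteq> 0 \<longleftrightarrow> (\<exists>k<t. h k = y \<and> h (Suc k) = y - 1)"
proof (induction t)
  case (Suc t)
  have "left_jumps (history h (Suc t)) = (if h (Suc t) = h t - 1
     then (left_jumps (history h t))(h t := Suc (left_jumps (history h t) (h t)))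
     else left_jumps (history h t))"
    by (cases t) (auto simp: Let_def)
  with Suc show ?case by (auto simp: less_Suc_eq)
qed auto

lemma right_prob_history:
  "right_prob (\<lambda>_. p) h t = (if left_jumps (history h t) (hd (history h t)) = 0 then p else 1/2)"
  using left_jumps_history[of h t "h t"]
  by (auto simp: right_prob_def jumped_left_before_def hd_history)

lemma pmf_cookie_walk_Suc:
  "pmf (cookie_walk p a (Suc t)) (y # xs) = pmf (cookie_walk p a t) xs * pmf (cookie_step p xs) (y # xs)"
proof -
  have "pmf (cookie_walk p a (Suc t)) (y # xs) = (\<integral>ys. pmf (cookie_step p ys) (y # xs) \<partial>cookie_walk p a t)"
    by (simp add: pmf_bind)
  also have "\<dots> = (\<integral>ys. pmf (cookie_step p xs) (y # xs) * indicator {xs} ys \<partial>cookie_walk p a t)"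
    by (intro Bochner_Integration.integral_cong)
       (auto simp: cookie_step_def pmf_eq_0_set_pmf indicator_def)
  also have "\<dots> = pmf (cookie_step p xs) (y # xs) * pmf (cookie_walk p a t) xs"
    by (simp add: measure_pmf_single)
  finally show ?thesis by simp
qed

lemma pmf_cookie_step:
  assumes "p \<in> {0..1}"
  defines "q xs \<equiv> (if left_jumps xs (hd xs) = 0 then p else 1/2)"
  shows "pmf (cookie_step p xs) (y # xs) =
    (if y = hd xs + 1 then q xs else if y = hd xs - 1 then 1 - q xs else 0)"
proof -
  have q: "0 \<le> q xs" "q xs \<le> 1" using assms by auto
  have "pmf (cookie_step p xs) (y # xs) =
     measure (bernoulli_pmf (q xs)) {c. (if c then hd xs + 1 else hd xs - 1) = y}"
    unfolding cookie_step_def q_def[symmetric] pmf_map by (simp add: vimage_def)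
  also have "{c. (if c then hd xs + 1 else hd xs - 1) = y} =
     (if y = hd xs + 1 then {True} else if y = hd xs - 1 then {False} else {})"
    by auto
  finally show ?thesis using q by (simp add: measure_pmf_single)
qed

context
  fixes M :: "'a measure" and p :: real and a :: int and X :: "nat \<Rightarrow> 'a \<Rightarrow> int"
  assumes walk: "cookie_random_walk M (\<lambda>_. p) a X"
begin

interpretation cookie_random_walk M "\<lambda>_. p" a X by (rule walk)

lemma history_sets: "{s \<in> space M. \<forall>i\<le>t. X i s = h i} \<in> sets M"
proof -
  have [measurable]: "X i \<in> M \<rightarrow>\<^sub>M count_space UNIV" for i by (rule rv)
  show ?thesis by measurable
qed

lemma prob_history_fun:
  "prob {s \<in> space M. \<forall>i\<le>t. X i s = h i} = pmf (cookie_walk p a t) (history h t)"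
proof (induction t)
  case 0
  have [measurable]: "X i \<in> M \<rightarrow>\<^sub>M count_space UNIV" for i by (rule rv)
  have "prob {s \<in> space M. X 0 s = h 0} = prob {s \<in> space M. a = h 0}"
    by (rule measure_eq_AE) (use start in auto)
  then show ?case by (cases "a = h 0") (simp_all add: prob_space)
next
  case (Suc t)
  have [measurable]: "X i \<in> M \<rightarrow>\<^sub>M count_space UNIV" for i by (rule rv)
  define E where "E = {s \<in> space M. \<forall>i\<le>t. X i s = h i}"
  define F where "F y = {s \<in> space M. X (Suc t) s = y \<and> (\<forall>i\<le>t. X i s = h i)}" for y
  have [measurable]: "E \<in> sets M" "F y \<in> sets M" for y unfolding E_def F_def by measurable
  have ev: "{s \<in> space M. \<forall>i\<le>Suc t. X i s = h i} = F (h (Suc t))"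
    by (auto simp: F_def le_Suc_eq)
  have FE: "F y \<subseteq> E" for y by (auto simp: E_def F_def)
  define q where "q = right_prob (\<lambda>_. p) h t"
  have FR: "prob (F (h t + 1)) = q * prob E" and FL: "prob (F (h t - 1)) = (1 - q) * prob E"
  proof -
    have "prob (F (h t + 1)) = q * prob E \<and> prob (F (h t - 1)) = (1 - q) * prob E"
    proof (cases "prob E > 0")
      case True
      then show ?thesis
        using step_right[of t h] step_left[of t h]
        unfolding cond_prob_def E_def[symmetric] F_def[symmetric] q_def[symmetric]
        by (simp_all add: divide_eq_eq)
    next
      \<comment> \<open>On a null history the conditional probability carries no information, but
        both sides vanish.\<close>
      case False
      then have "prob E = 0" using measure_nonneg[of M E] by linarith
      then have "prob (F y) = 0" for y
        using finite_measure_mono[OF FE, of y] measure_nonneg[of M "F y"] by simp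
      then show ?thesis using \<open>prob E = 0\<close> by simp
    qed
    then show "prob (F (h t + 1)) = q * prob E" "prob (F (h t - 1)) = (1 - q) * prob E" by auto
  qed
  \<comment> \<open>The right and left probabilities already exhaust the mass of \<open>E\<close>;
    this is where the process is seen to be nearest-neighbour.\<close>
  have F0: "prob (F y) = 0" if "y \<noteq> h t + 1" "y \<noteq> h t - 1" for y
  proof -
    have "prob (F y \<union> F (h t + 1) \<union> F (h t - 1)) = prob (F y) + prob (F (h t + 1)) + prob (F (h t - 1))"
    proof -
      have "(F y \<union> F (h t + 1)) \<inter> F (h t - 1) = {}" "F y \<inter> F (h t + 1) = {}"
        using that by (auto simp: F_def)
      then show ?thesis by (simp add: finite_measure_Union)
    qed
    moreover have "prob (F y \<union> F (h t + 1) \<union> F (h t - 1)) \<le> prob E"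
      using FE by (intro finite_measure_mono) auto
    ultimately have "prob (F y) \<le> 0" using FR FL by (simp add: algebra_simps)
    then show ?thesis using measure_nonneg[of M "F y"] by linarith
  qed
  have p: "p \<in> {0..1}" using env by auto
  have q: "q = (if left_jumps (history h t) (h t) = 0 then p else 1/2)"
    unfolding q_def right_prob_history hd_history ..
  show ?case
    unfolding ev history.simps pmf_cookie_walk_Suc pmf_cookie_step[OF p] hd_history q[symmetric]
    unfolding Suc.IH[symmetric] E_def[symmetric]
    using FR FL F0 by auto
qed

lemma prob_history:
  "prob {s \<in> space M. history (\<lambda>i. X i s) t \<in> A} = measure_pmf.prob (cookie_walk p a t) A"
proof -
  let ?H = "\<lambda>s. history (\<lambda>i. X i s) t"
  define g where "g xs = (SOME h. history h t = xs)" for xs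
  have g: "history (g xs) t = xs" if "length xs = Suc t" for xs
    unfolding g_def using ex_history[OF that] by (rule someI_ex)
  have pre: "?H -` {xs} \<inter> space M = 
    (if length xs = Suc t then {s \<in> space M. \<forall>i\<le>t. X i s = g xs i} else {})" for xs
  proof (cases "length xs = Suc t")
    case True
    have "history (\<lambda>i. X i s) t = xs \<longleftrightarrow> (\<forall>i\<le>t. X i s = g xs i)" for s
      using history_eq_iff[of "\<lambda>i. X i s" t "g xs"] unfolding g[OF True] .
    then show ?thesis using True by auto
  next
    case False
    then have "history (\<lambda>i. X i s) t \<noteq> xs" for s using length_history by metis
    then show ?thesis using False by auto
  qed
  have [measurable]: "?H \<in> M \<rightarrow>\<^sub>M count_space UNIV"
  proof -
    have "?H -` {xs} \<inter> space M \<in> sets M" for xs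
    proof (cases "length xs = Suc t")
      case True
      then show ?thesis unfolding pre if_P[OF True] by (intro history_sets)
    next
      case False
      then show ?thesis unfolding pre by simp
    qed
    then show ?thesis by (simp only: measurable_count_space_eq2_countable) blast
  qed
  have "distr M (count_space UNIV) ?H = measure_pmf (cookie_walk p a t)"
  proof (rule measure_eqI_countable[of _ UNIV])
    fix xs :: "int list"
    have "emeasure (distr M (count_space UNIV) ?H) {xs} = emeasure M (?H -` {xs} \<inter> space M)"
      by (simp add: emeasure_distr)
    also have "\<dots> = pmf (cookie_walk p a t) xs"
    proof (cases "length xs = Suc t")
      case True
      then show ?thesis unfolding pre by (simp add: emeasure_eq_measure prob_history_fun g)
    next
      case False
      then have "xs \<notin> set_pmf (cookie_walk p a t)" using cookie_walk_path by blast
      then show ?thesis unfolding pre using False by (simp add: pmf_eq_0_set_pmf)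
    qed
    finally show "emeasure (distr M (count_space UNIV) ?H) {xs} = emeasure (cookie_walk p a t) {xs}"
      by (simp add: emeasure_pmf_single)
  qed auto
  then have "measure (distr M (count_space UNIV) ?H) A = measure_pmf.prob (cookie_walk p a t) A" by simp
  then show ?thesis by (simp add: measure_distr vimage_def Int_def conj_commute)
qed

lemma AE_nn_path: "AE s in M. X 0 s = a \<and> (\<forall>t. \<bar>X (Suc t) s - X t s\<bar> = 1)"
proof -
  have [measurable]: "X i \<in> M \<rightarrow>\<^sub>M count_space UNIV" for i by (rule rv)
  have "AE s in M. \<bar>X (Suc t) s - X t s\<bar> = 1" for t
  proof -
    have "measure_pmf.prob (cookie_walk p a (Suc t)) {xs. \<bar>hd xs - hd (tl xs)\<bar> = 1} = 1"
    proof (subst measure_pmf.prob_eq_1, simp, unfold AE_measure_pmf_iff, safe)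
      fix xs assume "xs \<in> set_pmf (cookie_walk p a (Suc t))"
      then have "nn_path a xs" "length xs = Suc (Suc t)" by (simp_all only: cookie_walk_path)
      then show "\<bar>hd xs - hd (tl xs)\<bar> = 1" by (auto simp: length_Suc_conv)
    qed
    then have "prob {s \<in> space M. \<bar>X (Suc t) s - X t s\<bar> = 1} = 1"
      unfolding prob_history[symmetric] by (simp add: hd_history)
    then show ?thesis by (subst (asm) prob_eq_1) auto
  qed
  then show ?thesis using start by (simp add: AE_all_countable)
qed

text \<open>Statements on hitting times of the walk reduce to the chain through this identity; any
  number \<open>m\<close> of sites too large to be traversed by time \<open>T\<close> will
  do.\<close>

lemma prob_hits:
  assumes "0 < n" "n + T \<le> m"
  shows "prob {s \<in> space M. \<exists>k\<le>T. X k s = a + int n} =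
    measure_pmf.prob (hit_chain p n (a + int n) (\<lambda>_. 0) (\<lambda>_. 0) m) {w. n + 2 * snd w \<le> T}"
  unfolding prob_walk_hits[OF refl assms, symmetric] prob_history[symmetric] set_history
  by (intro arg_cong[where f = prob]) (auto simp: set_history image_iff Bex_def eq_commute)

end

section \<open>Monotonicity and block decomposition\<close>

lemma rel_pmf_bind_left:
  assumes "\<And>x. x \<in> set_pmf p \<Longrightarrow> rel_pmf R (f x) q"
  shows "rel_pmf R (bind_pmf p f) q"
proof -
  have "rel_pmf (\<lambda>x y. x = y \<and> x \<in> set_pmf p) p p"
    by (rule rel_pmf_reflI) auto
  then have "rel_pmf R (bind_pmf p f) (bind_pmf p (\<lambda>_. q))"
    by (rule rel_pmf_bindI) (use assms in auto)
  then show ?thesis by simp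
qed

text \<open>Thinning: a coin of bias \<open>p\<close> is a coin of bias \<open>q\<close> whose
  successes are kept with probability \<open>p / q\<close>.\<close>

lemma rel_pmf_bernoulli:
  assumes "0 \<le> p" "p \<le> q" "q \<le> 1"
  shows "rel_pmf (\<lambda>b c. c \<longrightarrow> b) (bernoulli_pmf q) (bernoulli_pmf p)"
proof (cases "q = 0")
  case False
  have "bernoulli_pmf p = bind_pmf (bernoulli_pmf q) (\<lambda>b. if b then bernoulli_pmf (p / q) else return_pmf False)"
  proof (rule pmf_eqI)
    fix b
    show "pmf (bernoulli_pmf p) b = pmf (bind_pmf (bernoulli_pmf q) (\<lambda>b. if b then bernoulli_pmf (p / q) else return_pmf False)) b"
      using assms False by (cases b) (simp_all add: pmf_bind field_simps)
  qed
  moreover have "rel_pmf (\<lambda>b c. c \<longrightarrow> b) (bind_pmf (bernoulli_pmf q) return_pmf)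
     (bind_pmf (bernoulli_pmf q) (\<lambda>b. if b then bernoulli_pmf (p / q) else return_pmf False))"
    by (rule rel_pmf_bindI[of "(=)"]) (auto simp: pmf.rel_refl rel_pmf_return_pmf1)
  ultimately show ?thesis by (simp add: bind_return_pmf')
next
  case True
  then have "p = q" using assms by simp
  then show ?thesis by (auto intro: rel_pmf_reflI)
qed

lemma fair_lefts_mono: "r \<le> r' \<Longrightarrow> rel_pmf (\<le>) (fair_lefts r) (fair_lefts r')"
proof (induction r arbitrary: r')
  case 0
  then show ?case by (simp add: rel_pmf_return_pmf1)
next
  case (Suc r)
  then obtain r'' where r': "r' = Suc r''" "r \<le> r''" by (cases r') auto
  show ?case unfolding r' neg_binomial_pmf_Suc pair_pmf_def map_bind_pmf
    by (rule rel_pmf_bindI[of "(=)"], simp add: pmf.rel_refl, rule rel_pmf_bindI[OF Suc.IH[OF r'(2)]])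
      (simp add: rel_pmf_return_pmf1)
qed

lemma map_Suc_fair_lefts_mono: "r \<le> r' \<Longrightarrow> rel_pmf (\<le>) (map_pmf Suc (fair_lefts r)) (map_pmf Suc (fair_lefts r'))"
  using fair_lefts_mono by (simp add: pmf.rel_map)

text \<open>Serves the mismatched branch of the coupling in \<open>cookie_lefts_mono\<close>, where
  the stronger cookie yields a right jump and the weaker one a left jump.\<close>

lemma cookie_lefts_le_fair: "r \<le> r' \<Longrightarrow> rel_pmf (\<le>) (cookie_lefts p r) (map_pmf Suc (fair_lefts r'))"
proof (induction r arbitrary: r')
  case 0
  then show ?case by (simp add: rel_pmf_return_pmf1)
next
  case (Suc r)
  show ?case unfolding cookie_lefts.simps
    by (rule rel_pmf_bind_left) (use Suc.IH[of r'] Suc.prems map_Suc_fair_lefts_mono in auto)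
qed

lemma cookie_lefts_mono:
  assumes "0 \<le> p" "p \<le> q" "q \<le> 1"
  shows "r \<le> r' \<Longrightarrow> rel_pmf (\<le>) (cookie_lefts q r) (cookie_lefts p r')"
proof (induction r arbitrary: r')
  case 0
  then show ?case by (simp add: rel_pmf_return_pmf1)
next
  case (Suc r)
  then obtain r'' where r': "r' = Suc r''" "r \<le> r''" by (cases r') auto
  show ?case unfolding r' cookie_lefts.simps
  proof (rule rel_pmf_bindI[OF rel_pmf_bernoulli[OF assms]])
    fix b c :: bool assume "c \<longrightarrow> b"
    moreover have "rel_pmf (\<le>) (map_pmf Suc (fair_lefts (Suc r))) (map_pmf Suc (fair_lefts (Suc r'')))"
      using r'(2) by (intro map_Suc_fair_lefts_mono) simp
    moreover have "rel_pmf (\<le>) (cookie_lefts q r) (map_pmf Suc (fair_lefts (Suc r'')))"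
      using r'(2) by (intro cookie_lefts_le_fair) simp
    moreover note Suc.IH[OF r'(2)]
    ultimately show "rel_pmf (\<le>) (if b then cookie_lefts q r else map_pmf Suc (fair_lefts (Suc r)))
        (if c then cookie_lefts p r'' else map_pmf Suc (fair_lefts (Suc r'')))"
      by auto
  qed
qed

lemma rel_pmf_nn_integral:
  fixes f g :: "_ \<Rightarrow> ennreal"
  assumes "rel_pmf R p q" "\<And>x y. R x y \<Longrightarrow> f x \<le> g y"
  shows "(\<integral>\<^sup>+x. f x \<partial>p) \<le> (\<integral>\<^sup>+y. g y \<partial>q)"
proof -
  obtain pq where pq: "\<And>x y. (x, y) \<in> set_pmf pq \<Longrightarrow> R x y" "map_pmf fst pq = p" "map_pmf snd pq = q"
    using assms(1) by (auto elim: rel_pmf.cases)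
  have "(\<integral>\<^sup>+x. f x \<partial>p) = (\<integral>\<^sup>+w. f (fst w) \<partial>pq)" unfolding pq(2)[symmetric] by simp
  also have "\<dots> \<le> (\<integral>\<^sup>+w. g (snd w) \<partial>pq)"
    by (intro nn_integral_mono_AE) (auto simp: AE_measure_pmf_iff intro!: assms(2) pq(1))
  also have "\<dots> = (\<integral>\<^sup>+y. g y \<partial>q)" unfolding pq(3)[symmetric] by simp
  finally show ?thesis .
qed

text \<open>The exploration chain of an unused environment to the right of the starting point.\<close>

definition sum_step :: "real \<Rightarrow> nat \<times> nat \<Rightarrow> (nat \<times> nat) pmf" where
  "sum_step p w = map_pmf (\<lambda>z. (z, snd w + z)) (cookie_lefts p (Suc (fst w)))"

primrec sum_chain :: "real \<Rightarrow> nat \<times> nat \<Rightarrow> nat \<Rightarrow> (nat \<times> nat) pmf" where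
  "sum_chain p w 0 = return_pmf w"
| "sum_chain p w (Suc k) = bind_pmf (sum_chain p w k) (sum_step p)"

lemma sum_chain_add: "sum_chain p w (j + k) = bind_pmf (sum_chain p w j) (\<lambda>v. sum_chain p v k)"
  by (induction k) (simp_all add: bind_return_pmf' bind_assoc_pmf)

lemma sum_chain_shift:
  "sum_chain p (z, s) k = map_pmf (\<lambda>w. (fst w, s + snd w)) (sum_chain p (z, 0) k)"
  by (induction k) 
     (simp_all add: map_bind_pmf bind_map_pmf sum_step_def map_pmf_comp add.assoc)

abbreviation le2 :: "nat \<times> nat \<Rightarrow> nat \<times> nat \<Rightarrow> bool" where
  "le2 w w' \<equiv> fst w \<le> fst w' \<and> snd w \<le> snd w'"

lemma sum_chain_mono:
  assumes "0 \<le> p" "p \<le> 1" "le2 w w'"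
  shows "rel_pmf le2 (sum_chain p w k) (sum_chain p w' k)"
proof (induction k)
  case 0
  then show ?case using assms(3) by (simp add: rel_pmf_return_pmf1)
next
  case (Suc k)
  show ?case unfolding sum_chain.simps
  proof (rule rel_pmf_bindI[OF Suc])
    fix v v' :: "nat \<times> nat" assume v: "le2 v v'"
    then have "rel_pmf (\<le>) (cookie_lefts p (Suc (fst v))) (cookie_lefts p (Suc (fst v')))"
      using assms by (intro cookie_lefts_mono) auto
    then show "rel_pmf le2 (sum_step p v) (sum_step p v')"
      unfolding sum_step_def pmf.rel_map by (rule pmf.rel_mono_strong) (use v in auto)
  qed
qed

abbreviation blank_chain :: "real \<Rightarrow> nat \<Rightarrow> int \<Rightarrow> nat \<Rightarrow> (nat \<times> nat) pmf" where
  "blank_chain p n b k \<equiv> hit_chain p n b (\<lambda>_. 0) (\<lambda>_. 0) k"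

lemma blank_chain_Suc:
  "blank_chain p n b (Suc k) = bind_pmf (blank_chain p n b k)
     (\<lambda>w. map_pmf (\<lambda>z. (z, snd w + z)) (cookie_lefts p (fst w + of_bool (k < n))))"
  by (simp add: site_lefts_fresh case_prod_unfold)

lemma blank_chain_eq_sum_chain: "k \<le> n \<Longrightarrow> blank_chain p n b k = sum_chain p (0, 0) k"
proof (induction k)
  case (Suc k)
  then show ?case unfolding blank_chain_Suc by (simp add: sum_step_def[abs_def] del: cookie_lefts.simps)
qed simp

text \<open>Stronger cookies give fewer left jumps and so earlier hits; this transfers bounds from
  parameters above 3/4 to those below.\<close>

lemma blank_chain_mono:
  assumes "0 \<le> p" "p \<le> q" "q \<le> 1"
  shows "rel_pmf le2 (blank_chain q n b k) (blank_chain p n b k)"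
proof (induction k)
  case 0
  then show ?case by (simp add: rel_pmf_return_pmf1)
next
  case (Suc k)
  show ?case unfolding blank_chain_Suc
  proof (rule rel_pmf_bindI[OF Suc])
    fix v v' :: "nat \<times> nat" assume v: "le2 v v'"
    then have "rel_pmf (\<le>) (cookie_lefts q (fst v + of_bool (k < n))) (cookie_lefts p (fst v' + of_bool (k < n)))"
      using assms by (intro cookie_lefts_mono) auto
    then show "rel_pmf le2 (map_pmf (\<lambda>z. (z, snd v + z)) (cookie_lefts q (fst v + of_bool (k < n))))
       (map_pmf (\<lambda>z. (z, snd v' + z)) (cookie_lefts p (fst v' + of_bool (k < n))))"
      unfolding pmf.rel_map by (rule pmf.rel_mono_strong) (use v in auto)
  qed
qed

lemma nn_integral_sum_chain_Suc:
  "(\<integral>\<^sup>+w. f w \<partial>sum_chain p v (Suc k)) =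
   (\<integral>\<^sup>+w. (\<integral>\<^sup>+z. f (z, snd w + z) \<partial>cookie_lefts p (Suc (fst w))) \<partial>sum_chain p v k)"
  by (simp add: nn_integral_bind_pmf sum_step_def)

lemma nn_integral_blank_chain_Suc:
  "(\<integral>\<^sup>+w. f w \<partial>blank_chain p n b (Suc k)) =
   (\<integral>\<^sup>+w. (\<integral>\<^sup>+z. f (z, snd w + z) \<partial>cookie_lefts p (fst w + of_bool (k < n))) \<partial>blank_chain p n b k)"
  unfolding blank_chain_Suc by (simp add: nn_integral_bind_pmf)

text \<open>Sites left of the starting point can only add to the total, so they may be dropped in
  lower tails.\<close>

lemma nn_integral_antimono_blank_chain:
  assumes "antimono f" "n \<le> N"
  shows "(\<integral>\<^sup>+w. f (snd w) \<partial>blank_chain p n b N) \<le> (\<integral>\<^sup>+w. f (snd w) \<partial>sum_chain p (0, 0) n)"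
  using assms(2)
proof (induction N rule: dec_induct)
  case base
  then show ?case by (simp only: blank_chain_eq_sum_chain)
next
  case (step k)
  have "(\<integral>\<^sup>+w. f (snd w) \<partial>blank_chain p n b (Suc k)) \<le> 
     (\<integral>\<^sup>+w. (\<integral>\<^sup>+z. f (snd w) \<partial>cookie_lefts p (fst w + of_bool (k < n))) \<partial>blank_chain p n b k)"
    unfolding nn_integral_blank_chain_Suc
    by (intro nn_integral_mono) (auto intro!: antimonoD[OF assms(1)])
  also have "\<dots> = (\<integral>\<^sup>+w. f (snd w) \<partial>blank_chain p n b k)" by simp
  finally show ?case using step.IH by simp
qed

text \<open>After the first \<open>k - j\<close> steps the chain is at least 0, and the last
  \<open>j\<close> steps are monotone in the state from which they start.\<close>

lemma sum_chain_moments_mono: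
  fixes f :: "nat \<Rightarrow> ennreal"
  assumes "0 \<le> p" "p \<le> 1" "mono f" "j \<le> k"
  shows "(\<integral>\<^sup>+w. f (fst w) \<partial>sum_chain p (0, 0) j) \<le> (\<integral>\<^sup>+w. f (fst w) \<partial>sum_chain p (0, 0) k)"
proof -
  have "(\<integral>\<^sup>+w. f (fst w) \<partial>sum_chain p (0, 0) j) = 
    (\<integral>\<^sup>+v. (\<integral>\<^sup>+w. f (fst w) \<partial>sum_chain p (0, 0) j) \<partial>sum_chain p (0, 0) (k - j))" by simp
  also have "\<dots> \<le> (\<integral>\<^sup>+v. (\<integral>\<^sup>+w. f (fst w) \<partial>sum_chain p v j) \<partial>sum_chain p (0, 0) (k - j))"
    using assms by (intro nn_integral_mono rel_pmf_nn_integral[OF sum_chain_mono]) (auto simp: mono_def)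
  also have "\<dots> = (\<integral>\<^sup>+w. f (fst w) \<partial>sum_chain p (0, 0) (k - j + j))"
    unfolding sum_chain_add by (simp add: nn_integral_bind_pmf)
  finally show ?thesis using assms by simp
qed

text \<open>Restarting the chain at \<open>0\<close> after each block only decreases it, and makes the block sums
  independent.\<close>

primrec iid_sum :: "nat pmf \<Rightarrow> nat \<Rightarrow> nat pmf" where
  "iid_sum q 0 = return_pmf 0"
| "iid_sum q (Suc k) = bind_pmf (iid_sum q k) (\<lambda>s. map_pmf ((+) s) q)"

lemma integrable_of_square:
  fixes q :: "'b pmf" and f :: "'b \<Rightarrow> nat"
  assumes "(\<integral>\<^sup>+y. ennreal (real (f y) ^ 2) \<partial>q) < \<infinity>"
  shows "integrable q (\<lambda>y. real (f y) ^ 2)" "integrable q (\<lambda>y. real (f y))"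
proof -
  show *: "integrable q (\<lambda>y. real (f y) ^ 2)"
    by (rule integrableI_bounded) (use assms in auto)
  have "real n \<le> real n ^ 2" for n by (cases n) (auto simp: power2_eq_square)
  then show "integrable q (\<lambda>y. real (f y))"
    by (intro Bochner_Integration.integrable_bound[OF *]) auto
qed

text \<open>Variances add, each bounded by the second moment \<open>v\<close>. The centre
  \<open>c\<close> is free because the induction shifts it by the mean of one summand.\<close>

lemma iid_sum_square:
  fixes q :: "nat pmf"
  assumes q2: "(\<integral>\<^sup>+y. ennreal (real y ^ 2) \<partial>q) \<le> ennreal v" and v: "0 \<le> v"
  defines "m \<equiv> measure_pmf.expectation q real"
  shows "(\<integral>\<^sup>+x. ennreal ((c - real x) ^ 2) \<partial>iid_sum q k) \<le> ennreal ((c - real k * m) ^ 2 + real k * v)"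
proof (induction k arbitrary: c)
  case 0
  then show ?case by simp
next
  case (Suc k)
  have fin: "(\<integral>\<^sup>+y. ennreal (real y ^ 2) \<partial>q) < \<infinity>" using q2 by (simp add: order_le_less_trans)
  note int = integrable_of_square[OF fin]
  have "ennreal (measure_pmf.expectation q (\<lambda>y. real y ^ 2)) = (\<integral>\<^sup>+y. ennreal (real y ^ 2) \<partial>q)"
    using int by (subst nn_integral_eq_integral) auto
  with q2 v have Ev: "measure_pmf.expectation q (\<lambda>y. real y ^ 2) \<le> v" by (metis ennreal_le_iff)
  have inner: "(\<integral>\<^sup>+y. ennreal ((c - real y) ^ 2) \<partial>q) \<le> ennreal ((c - m) ^ 2 + v)" for c
  proof -
    have "(\<lambda>y. (c - real y) ^ 2) = (\<lambda>y. (c ^ 2 + - (2 * c) * real y) + real y ^ 2)"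
      by (auto simp: power2_diff)
    moreover have "integrable q (\<lambda>y. (c ^ 2 + - (2 * c) * real y) + real y ^ 2)"
      by (intro Bochner_Integration.integrable_add int integrable_mult_right) simp
    moreover have "measure_pmf.expectation q (\<lambda>y. (c ^ 2 + - (2 * c) * real y) + real y ^ 2) =
       c ^ 2 + - (2 * c) * m + measure_pmf.expectation q (\<lambda>y. real y ^ 2)"
      using int by (simp add: m_def)
    ultimately have "(\<integral>\<^sup>+y. ennreal ((c - real y) ^ 2) \<partial>q) =
       ennreal (c ^ 2 + - (2 * c) * m + measure_pmf.expectation q (\<lambda>y. real y ^ 2))"
      by (subst nn_integral_eq_integral) auto
    also have "\<dots> \<le> ennreal ((c - m) ^ 2 + v)"
      using Ev by (intro ennreal_leI) (simp add: power2_diff add_increasing)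
    finally show ?thesis .
  qed
  have "(\<integral>\<^sup>+x. ennreal ((c - real x) ^ 2) \<partial>iid_sum q (Suc k)) = 
     (\<integral>\<^sup>+x. (\<integral>\<^sup>+y. ennreal (((c - real x) - real y) ^ 2) \<partial>q) \<partial>iid_sum q k)"
    by (simp add: nn_integral_bind_pmf algebra_simps)
  also have "\<dots> \<le> (\<integral>\<^sup>+x. ennreal ((c - real x - m) ^ 2 + v) \<partial>iid_sum q k)"
    by (intro nn_integral_mono inner)
  also have "\<dots> = (\<integral>\<^sup>+x. ennreal (((c - m) - real x) ^ 2) \<partial>iid_sum q k) + ennreal v"
    using v by (simp add: ennreal_plus nn_integral_add algebra_simps)
  also have "\<dots> \<le> ennreal (((c - m) - real k * m) ^ 2 + real k * v) + ennreal v"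
    by (intro add_right_mono Suc)
  also have "\<dots> = ennreal ((c - real (Suc k) * m) ^ 2 + real (Suc k) * v)"
    using v by (simp flip: ennreal_plus add: algebra_simps)
  finally show ?case .
qed

lemma iid_sum_le_sum_chain:
  assumes "0 \<le> p" "p \<le> 1"
  shows "rel_pmf (\<lambda>s w. s \<le> snd w) (iid_sum (map_pmf snd (sum_chain p (0, 0) B)) k) (sum_chain p (0, 0) (k * B))"
proof (induction k)
  case 0
  then show ?case by (simp add: rel_pmf_return_pmf1)
next
  case (Suc k)
  have eq: "sum_chain p (0, 0) (Suc k * B) = bind_pmf (sum_chain p (0, 0) (k * B)) (\<lambda>v. sum_chain p v B)"
    unfolding sum_chain_add[symmetric] by (simp add: add.commute)
  show ?case unfolding eq iid_sum.simps
  proof (rule rel_pmf_bindI[OF Suc])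
    fix s and w :: "nat \<times> nat" assume "s \<le> snd w"
    then have "rel_pmf le2 (sum_chain p (0, s) B) (sum_chain p w B)"
      using assms by (intro sum_chain_mono) auto
    then have "rel_pmf (\<lambda>x y. s + snd x \<le> snd y) (sum_chain p (0, 0) B) (sum_chain p w B)"
      unfolding sum_chain_shift[of p 0 s] pmf.rel_map by (rule pmf.rel_mono_strong) auto
    then show "rel_pmf (\<lambda>s w. s \<le> snd w) (map_pmf ((+) s) (map_pmf snd (sum_chain p (0, 0) B))) (sum_chain p w B)"
      by (simp add: pmf.rel_map)
  qed
qed

text \<open>The square of \<open>x - \<theta>\<close> is nonnegative. The free scale \<theta> turns
  a bound on squares into a bound of order \<theta> on positive parts.\<close>

lemma positive_part_le: 
  fixes x \<theta> :: real
  assumes "0 < \<theta>"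
  shows "max 0 x \<le> x ^ 2 / (2 * \<theta>) + \<theta> / 2"
proof -
  have "0 \<le> (x - \<theta>) ^ 2 / (2 * \<theta>)" using assms by simp
  also have "\<dots> = x ^ 2 / (2 * \<theta>) - x + \<theta> / 2" using assms by (simp add: field_simps power2_eq_square)
  finally show ?thesis using assms by simp
qed

text \<open>There are \<open>k\<close> independent blocks of length \<open>B\<close>. The centre
  \<open>c\<close> may differ from the mean of their sum; that bias enters through the first
  square.\<close>

lemma sum_chain_deficit:
  assumes "0 \<le> p" "p \<le> 1" "0 < \<theta>" "0 \<le> v"
    and "(\<integral>\<^sup>+w. ennreal (real (snd w) ^ 2) \<partial>sum_chain p (0, 0) B) \<le> ennreal v"
  defines "m \<equiv> measure_pmf.expectation (sum_chain p (0, 0) B) (\<lambda>w. real (snd w))"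
  shows "(\<integral>\<^sup>+w. ennreal (max 0 (c - real (snd w))) \<partial>sum_chain p (0, 0) (k * B)) \<le> 
    ennreal (((c - real k * m) ^ 2 + real k * v) / (2 * \<theta>) + \<theta> / 2)"
proof -
  let ?q = "map_pmf snd (sum_chain p (0, 0) B)"
  have "(\<integral>\<^sup>+w. ennreal (max 0 (c - real (snd w))) \<partial>sum_chain p (0, 0) (k * B)) \<le>
    (\<integral>\<^sup>+s. ennreal (max 0 (c - real s)) \<partial>iid_sum ?q k)"
  proof (rule rel_pmf_nn_integral)
    show "rel_pmf (\<lambda>s w. s \<le> snd w)\<inverse>\<inverse> (sum_chain p (0, 0) (k * B)) (iid_sum ?q k)"
      using iid_sum_le_sum_chain[OF assms(1,2)] by (simp add: pmf.rel_conversep)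
  qed (auto intro!: ennreal_leI)
  also have "\<dots> \<le> (\<integral>\<^sup>+s. ennreal (1 / (2 * \<theta>)) * ennreal ((c - real s) ^ 2) + ennreal (\<theta> / 2) \<partial>iid_sum ?q k)"
  proof (rule nn_integral_mono)
    fix s :: nat
    have "ennreal (max 0 (c - real s)) \<le> ennreal (1 / (2 * \<theta>) * (c - real s) ^ 2 + \<theta> / 2)"
      using positive_part_le[OF assms(3)] by (intro ennreal_leI) simp
    also have "\<dots> = ennreal (1 / (2 * \<theta>)) * ennreal ((c - real s) ^ 2) + ennreal (\<theta> / 2)"
      using assms(3) by (subst ennreal_plus; (subst ennreal_mult)?; simp)
    finally show "ennreal (max 0 (c - real s)) \<le> ennreal (1 / (2 * \<theta>)) * ennreal ((c - real s) ^ 2) + ennreal (\<theta> / 2)" .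
  qed
  also have "\<dots> = ennreal (1 / (2 * \<theta>)) * (\<integral>\<^sup>+s. ennreal ((c - real s) ^ 2) \<partial>iid_sum ?q k) + ennreal (\<theta> / 2)"
    by (simp add: nn_integral_add nn_integral_cmult)
  also have "\<dots> \<le> ennreal (1 / (2 * \<theta>)) * ennreal ((c - real k * m) ^ 2 + real k * v) + ennreal (\<theta> / 2)"
    using iid_sum_square[where q = ?q and v = v and c = c and k = k] assms(4,5) by (intro add_right_mono mult_left_mono) (auto simp: m_def)
  also have "\<dots> = ennreal (((c - real k * m) ^ 2 + real k * v) / (2 * \<theta>) + \<theta> / 2)"
    using assms(3,4) by (subst ennreal_mult[symmetric]) (auto simp flip: ennreal_plus)
  finally show ?thesis .
qed

section \<open>Moment estimates\<close>

lemma nn_integral_bernoulli_bind: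
  assumes "0 \<le> p" "p \<le> 1"
  shows "(\<integral>\<^sup>+x. f x \<partial>bind_pmf (bernoulli_pmf p) g) =
    ennreal p * (\<integral>\<^sup>+x. f x \<partial>g True) + ennreal (1 - p) * (\<integral>\<^sup>+x. f x \<partial>g False)"
  using assms by (simp add: nn_integral_bind_pmf mult.commute)

text \<open>\<open>e\<close> is the explicit tail of the series.\<close>

lemma nn_integral_geometric_half:
  assumes "\<And>N. (\<Sum>n<N. f n * (1/2) ^ Suc n) = c - e N" "e \<longlonglongrightarrow> 0" "\<And>n. 0 \<le> f n"
  shows "(\<integral>\<^sup>+n. ennreal (f n) \<partial>geometric_pmf (1/2)) = ennreal c"
proof -
  have "(\<lambda>N. \<Sum>n<N. f n * (1/2) ^ Suc n) \<longlonglongrightarrow> c - 0"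
    unfolding assms(1) by (intro tendsto_intros assms(2))
  then have sums: "(\<lambda>n. f n * (1/2) ^ Suc n) sums c" by (simp add: sums_def)
  have "(\<integral>\<^sup>+n. ennreal (f n) \<partial>geometric_pmf (1/2)) = (\<Sum>n. ennreal (f n * (1/2) ^ Suc n))"
    by (simp add: nn_integral_measure_pmf nn_integral_count_space_nat pmf_geometric 
        ennreal_mult'[symmetric] mult_ac assms(3))
  also have "\<dots> = ennreal (\<Sum>n. f n * (1/2) ^ Suc n)"
    using sums assms(3) by (intro suminf_ennreal2) (auto simp: sums_iff)
  finally show ?thesis using sums by (simp add: sums_iff)
qed

lemma geometric_half_moments:
  "(\<integral>\<^sup>+n. ennreal (real n) \<partial>geometric_pmf (1/2)) = ennreal 1"
  "(\<integral>\<^sup>+n. ennreal (real n ^ 2) \<partial>geometric_pmf (1/2)) = ennreal 3"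
  "(\<integral>\<^sup>+n. ennreal (real n ^ 3) \<partial>geometric_pmf (1/2)) = ennreal 13"
proof -
  have 1: "(\<Sum>n<N. real n * (1/2) ^ Suc n) = 1 - (real N + 1) * (1/2) ^ N" for N
    by (induction N) (auto simp: field_simps)
  have 2: "(\<Sum>n<N. real n ^ 2 * (1/2) ^ Suc n) = 3 - (real N ^ 2 + 2 * real N + 3) * (1/2) ^ N" for N
    by (induction N) (auto simp: field_simps power2_eq_square)
  have 3: "(\<Sum>n<N. real n ^ 3 * (1/2) ^ Suc n) = 
      13 - (real N ^ 3 + 3 * real N ^ 2 + 9 * real N + 13) * (1/2) ^ N" for N
    by (induction N) (auto simp: field_simps power2_eq_square power3_eq_cube)
  show "(\<integral>\<^sup>+n. ennreal (real n) \<partial>geometric_pmf (1/2)) = ennreal 1"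
    by (rule nn_integral_geometric_half[OF 1]) (real_asymp, simp)
  show "(\<integral>\<^sup>+n. ennreal (real n ^ 2) \<partial>geometric_pmf (1/2)) = ennreal 3"
    by (rule nn_integral_geometric_half[OF 2]) (real_asymp, simp)
  show "(\<integral>\<^sup>+n. ennreal (real n ^ 3) \<partial>geometric_pmf (1/2)) = ennreal 13"
    by (rule nn_integral_geometric_half[OF 3]) (real_asymp, simp)
qed

lemma nn_integral_cubic:
  fixes M :: "nat pmf"
  assumes "(\<integral>\<^sup>+n. ennreal (real n) \<partial>M) = ennreal m1"
    "(\<integral>\<^sup>+n. ennreal (real n ^ 2) \<partial>M) = ennreal m2"
    "(\<integral>\<^sup>+n. ennreal (real n ^ 3) \<partial>M) = ennreal m3"
    "0 \<le> m1" "0 \<le> m2" "0 \<le> m3" "0 \<le> a" "0 \<le> b" "0 \<le> c" "0 \<le> d"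
    "\<And>n. f n = a + b * real n + c * real n ^ 2 + d * real n ^ 3"
    "v = a + b * m1 + c * m2 + d * m3"
  shows "(\<integral>\<^sup>+n. ennreal (f n) \<partial>M) = ennreal v"
  using assms by (simp add: ennreal_plus ennreal_mult nn_integral_add nn_integral_cmult)

lemma fair_lefts_moments:
  "(\<integral>\<^sup>+n. ennreal (real n) \<partial>fair_lefts r) = ennreal (real r)"
  "(\<integral>\<^sup>+n. ennreal (real n ^ 2) \<partial>fair_lefts r) = ennreal (real r ^ 2 + 2 * real r)"
  "(\<integral>\<^sup>+n. ennreal (real n ^ 3) \<partial>fair_lefts r) = ennreal (real r ^ 3 + 6 * real r ^ 2 + 6 * real r)"
proof (induction r)
  case (Suc r)
  note cubic = nn_integral_cubic[OF Suc.IH]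
  note gcubic = nn_integral_cubic[OF geometric_half_moments]
  have pair: "(\<integral>\<^sup>+n. ennreal (f n) \<partial>fair_lefts (Suc r)) = 
     (\<integral>\<^sup>+x. (\<integral>\<^sup>+y. ennreal (f (x + y)) \<partial>fair_lefts r) \<partial>geometric_pmf (1/2))" for f
    by (simp add: neg_binomial_pmf_Suc nn_integral_pair_pmf')
  { case 1
    have "(\<integral>\<^sup>+y. ennreal (real (x + y)) \<partial>fair_lefts r) = ennreal (real r + real x)" for x
      by (rule cubic[where a = "real x" and b = 1 and c = 0 and d = 0]) auto
    then show ?case unfolding pair
      by (simp only:) (rule gcubic[where a = "real r" and b = 1 and c = 0 and d = 0]; simp) }
  { case 2
    have "(\<integral>\<^sup>+y. ennreal (real (x + y) ^ 2) \<partial>fair_lefts r) = 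
      ennreal ((real r ^ 2 + 2 * real r) + (2 * real r) * real x + 1 * real x ^ 2)" for x
      by (rule cubic[where a = "real x ^ 2" and b = "2 * real x" and c = 1 and d = 0])
        (auto simp: power2_eq_square algebra_simps)
    then show ?case unfolding pair
      by (simp only:) (rule gcubic[where a = "real r ^ 2 + 2 * real r" and b = "2 * real r" and c = 1 and d = 0]; 
          simp add: power2_eq_square algebra_simps) }
  { case 3
    have "(\<integral>\<^sup>+y. ennreal (real (x + y) ^ 3) \<partial>fair_lefts r) = 
      ennreal ((real r ^ 3 + 6 * real r ^ 2 + 6 * real r) + 3 * (real r ^ 2 + 2 * real r) * real x 
        + (3 * real r) * real x ^ 2 + 1 * real x ^ 3)" for x
      by (rule cubic[where a = "real x ^ 3" and b = "3 * real x ^ 2" and c = "3 * real x" and d = 1])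
        (auto simp: power2_eq_square power3_eq_cube algebra_simps)
    then show ?case unfolding pair 
      by (simp only:) (rule gcubic[where a = "real r ^ 3 + 6 * real r ^ 2 + 6 * real r" and
            b = "3 * (real r ^ 2 + 2 * real r)" and c = "3 * real r" and d = 1]; 
          simp add: power2_eq_square power3_eq_cube algebra_simps) }
qed auto

lemmas fair_lefts_cubic = nn_integral_cubic[OF fair_lefts_moments]

text \<open>Conditioning on the first coin makes moments solve an affine recursion in
  \<open>r\<close>: \<open>g\<close> is the candidate for a fresh site, \<open>k\<close> the value
  after a first left jump, with all \<open>Suc r\<close> right jumps still due.\<close>

lemma cookie_lefts_induct_eq:
  assumes "0 \<le> p" "p \<le> 1" "\<And>z. 0 \<le> f z" "\<And>r. 0 \<le> g r" "\<And>r. 0 \<le> k r" "f 0 = g 0"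
    "\<And>r. (\<integral>\<^sup>+z. ennreal (f (Suc z)) \<partial>fair_lefts r) = ennreal (k r)"
    "\<And>r. p * g r + (1 - p) * k (Suc r) = g (Suc r)"
  shows "(\<integral>\<^sup>+z. ennreal (f z) \<partial>cookie_lefts p r) = ennreal (g r)"
proof (induction r)
  case (Suc r)
  have "(\<integral>\<^sup>+z. ennreal (f z) \<partial>cookie_lefts p (Suc r)) = 
    ennreal p * ennreal (g r) + ennreal (1 - p) * ennreal (k (Suc r))"
    unfolding cookie_lefts.simps nn_integral_bernoulli_bind[OF assms(1,2)]
    using assms(7)[of "Suc r"] Suc by (simp del: neg_binomial_pmf.simps)
  also have "\<dots> = ennreal (g (Suc r))"
    using assms by (simp flip: ennreal_mult ennreal_plus)
  finally show ?case .
qed (simp add: assms)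

lemma cookie_lefts_induct_le:
  assumes "0 \<le> p" "p \<le> 1" "\<And>z. 0 \<le> f z" "\<And>r. 0 \<le> g r" "\<And>r. 0 \<le> k r" "f 0 \<le> g 0"
    "\<And>r. (\<integral>\<^sup>+z. ennreal (f (Suc z)) \<partial>fair_lefts r) = ennreal (k r)"
    "\<And>r. p * g r + (1 - p) * k (Suc r) \<le> g (Suc r)"
  shows "(\<integral>\<^sup>+z. ennreal (f z) \<partial>cookie_lefts p r) \<le> ennreal (g r)"
proof (induction r)
  case (Suc r)
  have "(\<integral>\<^sup>+z. ennreal (f z) \<partial>cookie_lefts p (Suc r)) \<le> 
    ennreal p * ennreal (g r) + ennreal (1 - p) * ennreal (k (Suc r))"
    unfolding cookie_lefts.simps nn_integral_bernoulli_bind[OF assms(1,2)]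
    using assms(7)[of "Suc r"] Suc by (simp add: mult_left_mono del: neg_binomial_pmf.simps)
  also have "\<dots> \<le> ennreal (g (Suc r))"
    using assms by (simp flip: ennreal_mult ennreal_plus)
  finally show ?case .
qed (simp add: assms)

lemma fair_lefts_Suc_square: 
  assumes "0 \<le> c"
  shows "(\<integral>\<^sup>+z. ennreal (real (Suc z) ^ 2 + c * real (Suc z)) \<partial>fair_lefts r) = 
    ennreal (real r ^ 2 + (4 + c) * real r + (1 + c))"
  by (rule fair_lefts_cubic[where a = "1 + c" and b = "2 + c" and c = 1 and d = 0])
    (use assms in \<open>auto simp: power2_eq_square algebra_simps\<close>)

lemma fair_lefts_Suc_cube: 
  "(\<integral>\<^sup>+z. ennreal (real (Suc z) ^ 3) \<partial>fair_lefts r) = 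
    ennreal (real r ^ 3 + 9 * real r ^ 2 + 15 * real r + 1)"
  by (rule fair_lefts_cubic[where a = 1 and b = 3 and c = 3 and d = 1])
    (auto simp: power2_eq_square power3_eq_cube algebra_simps)

text \<open>The bound is the moment of a site that has already jumped left once; being increasing in
  \<open>r\<close>, it is a supersolution of the recursion.\<close>

lemma cookie_lefts_cube:
  assumes "0 \<le> p" "p \<le> 1"
  shows "(\<integral>\<^sup>+z. ennreal (real z ^ 3) \<partial>cookie_lefts p r) \<le> 
    ennreal (real r ^ 3 + 9 * real r ^ 2 + 15 * real r + 1)"
proof (rule cookie_lefts_induct_le[OF assms _ _ _ _ fair_lefts_Suc_cube])
  fix r
  let ?k = "\<lambda>r. real r ^ 3 + 9 * real r ^ 2 + 15 * real r + 1"
  have "?k r \<le> ?k (Suc r)" by (intro add_mono mult_left_mono power_mono) auto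
  then have "p * ?k r \<le> p * ?k (Suc r)" using assms by (intro mult_left_mono)
  then show "p * ?k r + (1 - p) * ?k (Suc r) \<le> ?k (Suc r)" by (simp add: algebra_simps)
qed auto

lemma ennreal_lincomb:
  "0 \<le> a \<Longrightarrow> 0 \<le> b \<Longrightarrow> 0 \<le> x \<Longrightarrow> 0 \<le> y \<Longrightarrow>
    ennreal (a * x + b * y) = ennreal a * ennreal x + ennreal b * ennreal y"
  by (simp add: ennreal_plus ennreal_mult)

lemma powr_le_tangent:
  fixes x :: real
  assumes "0 \<le> x" "0 < s" "s \<le> 1"
  shows "x powr s \<le> 1 + s * (x - 1)"
proof (cases "x = 0")
  case False
  then show ?thesis
    using Youngs_inequality_0[of s "1 - s" x 1] assms by (simp add: algebra_simps)
qed (use assms in simp)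

text \<open>The concave case with exponent \<open>1 / a\<close>, applied to
  \<open>x powr a\<close>.\<close>

lemma powr_ge_tangent:
  fixes x :: real
  assumes "0 \<le> x" "1 \<le> a"
  shows "1 + a * (x - 1) \<le> x powr a"
proof -
  have "(x powr a) powr (1 / a) \<le> 1 + 1 / a * (x powr a - 1)"
    by (rule powr_le_tangent) (use assms in auto)
  moreover have "(x powr a) powr (1 / a) = x" using assms by (simp add: powr_powr)
  ultimately have "a * x \<le> a * (1 + 1 / a * (x powr a - 1))" using assms by (intro mult_left_mono) auto
  then show ?thesis using assms by (simp add: algebra_simps)
qed

text \<open>Convexity: the increment is at most the derivative at the right end point.\<close>

lemma powr_Suc_le:
  assumes "1 \<le> a"
  shows "real (Suc j) powr a \<le> real j powr a + a * real (Suc j) powr (a - 1)"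
proof -
  let ?r = "real (Suc j)"
  have "1 + a * (real j / ?r - 1) \<le> (real j / ?r) powr a"
    by (rule powr_ge_tangent) (use assms in auto)
  then have "(1 + a * (real j / ?r - 1)) * ?r powr a \<le> (real j / ?r) powr a * ?r powr a"
    by (intro mult_right_mono) auto
  also have "\<dots> = real j powr a" by (simp add: powr_divide)
  also have "(1 + a * (real j / ?r - 1)) * ?r powr a = ?r powr a - a * (?r powr a / ?r)"
    by (simp add: field_simps)
  also have "?r powr a / ?r = ?r powr (a - 1)" by (simp add: powr_diff)
  finally show ?thesis by simp
qed

text \<open>Bounding \<open>z powr s\<close> by its tangent at \<open>r\<close> leaves only integer moments, which are explicit.\<close>

lemma powr_cubic_bound:
  fixes z r :: real
  assumes "0 \<le> z" "0 < r" "0 < s" "s \<le> 1"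
  shows "z powr (2 + s) \<le> r powr s * ((1 - s) * z ^ 2 + s / r * z ^ 3)"
proof -
  have "z powr (2 + s) = z ^ 2 * r powr s * (z / r) powr s"
    using assms by (cases "z = 0") (auto simp: powr_add powr_divide)
  also have "\<dots> \<le> z ^ 2 * r powr s * (1 + s * (z / r - 1))"
    using assms by (intro mult_left_mono powr_le_tangent) auto
  also have "\<dots> = r powr s * ((1 - s) * z ^ 2 + s / r * z ^ 3)"
    by (simp add: algebra_simps power2_eq_square power3_eq_cube)
  finally show ?thesis .
qed

section \<open>Drift and moments of the chain for 3/4 < p < 1\<close>

context
  fixes p \<mu> :: real
  assumes p: "3/4 < p" "p < 1" and mu: "\<mu> = p / (1 - p)"
begin

lemma mu_gt_3: "3 < \<mu>" and mu_p: "\<mu> * (1 - p) = p"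
  using p by (auto simp: mu field_simps)

lemma cookie_lefts_quadratic:
  "(\<integral>\<^sup>+z. ennreal (real z ^ 2 + (2 * \<mu> - 1) * real z) \<partial>cookie_lefts p r) = ennreal (real r ^ 2 + 3 * real r)"
proof (rule cookie_lefts_induct_eq[OF _ _ _ _ _ _ fair_lefts_Suc_square])
  fix r
  have "p * (real r ^ 2 + 3 * real r) + (1 - p) * (real (Suc r) ^ 2 + (4 + (2 * \<mu> - 1)) * real (Suc r) + (1 + (2 * \<mu> - 1)))
    = p * (real r ^ 2 + 3 * real r) + (1 - p) * (real r ^ 2 + 5 * real r + 4) + 2 * (\<mu> * (1 - p)) * (real r + 2)"
    by (simp add: power2_eq_square algebra_simps)
  also have "\<dots> = real (Suc r) ^ 2 + 3 * real (Suc r)" unfolding mu_p by (simp add: power2_eq_square algebra_simps)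
  finally show "p * (real r ^ 2 + 3 * real r) + (1 - p) * (real (Suc r) ^ 2 + (4 + (2 * \<mu> - 1)) * real (Suc r) + (1 + (2 * \<mu> - 1)))
    = real (Suc r) ^ 2 + 3 * real (Suc r)" .
qed (use p mu_gt_3 in auto)

text \<open>\<open>g\<close> solves the recursion of the second moment exactly and is too large only
  at 0, so the bound gives away no more than a multiple of p^r. Its linear coefficient is the source
  of the negative drift below.\<close>

lemma cookie_lefts_square_bound:
  defines "g \<equiv> \<lambda>r. real r ^ 2 - (2 * \<mu> - 4) * real r + (2 * \<mu> - 1) * (\<mu> - 1)"
  shows "(\<integral>\<^sup>+z. ennreal (real z ^ 2) \<partial>cookie_lefts p r) \<le> ennreal (g r)" and "0 \<le> g r"
proof -
  have g0: "0 \<le> g r" for r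
  proof -
    have "g r = (real r - (\<mu> - 2)) ^ 2 + (\<mu> * \<mu> + \<mu> - 3)" by (simp add: g_def power2_eq_square algebra_simps)
    moreover have "3 * 3 \<le> \<mu> * \<mu>" using mu_gt_3 by (intro mult_mono) auto
    ultimately show ?thesis using mu_gt_3 by simp
  qed
  then show "0 \<le> g r" .
  show "(\<integral>\<^sup>+z. ennreal (real z ^ 2) \<partial>cookie_lefts p r) \<le> ennreal (g r)"
  proof (rule cookie_lefts_induct_le[where k = "\<lambda>r. real r ^ 2 + 4 * real r + 1"])
    show "(\<integral>\<^sup>+z. ennreal (real (Suc z) ^ 2) \<partial>fair_lefts r) = ennreal (real r ^ 2 + 4 * real r + 1)" for r
      using fair_lefts_Suc_square[of 0 r] by (simp only: mult_zero_left add_0_right)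
    fix r
    have "g (Suc r) - (p * g r + (1 - p) * (real (Suc r) ^ 2 + 4 * real (Suc r) + 1)) =
      (2 * \<mu> - 2 * real r - 5) * (\<mu> * (1 - p) - p)"
      by (simp add: g_def power2_eq_square algebra_simps)
    also have "\<dots> = 0" by (simp add: mu_p)
    finally show "p * g r + (1 - p) * (real (Suc r) ^ 2 + 4 * real (Suc r) + 1) \<le> g (Suc r)" by simp
  qed (use p mu_gt_3 g0 in \<open>auto simp: g_def\<close>)
qed

definition lyap :: "nat \<Rightarrow> real" where "lyap z = real z ^ 2 + (2 * \<mu> - 1) * real z"

lemma lyap_nonneg: "0 \<le> lyap z" and lyap_square: "real z ^ 2 \<le> lyap z" and lyap_linear: "c \<le> 2 * \<mu> - 1 \<Longrightarrow> c * real z \<le> lyap z"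
  using mu_gt_3 by (auto simp: lyap_def intro!: add_increasing mult_right_mono)

lemma lyap_le: "lyap z \<le> 2 * \<mu> * real z ^ 2"
proof -
  have "real z \<le> real z ^ 2" by (cases z) (auto simp: power2_eq_square)
  then have "(2 * \<mu> - 1) * real z \<le> (2 * \<mu> - 1) * real z ^ 2" using mu_gt_3 by (intro mult_left_mono) auto
  then show ?thesis by (simp add: lyap_def algebra_simps)
qed

lemma lyapunov_nonneg: "0 \<le> c \<Longrightarrow> c \<le> 2 * \<mu> - 1 \<Longrightarrow> 0 \<le> c * (real s - real z) + lyap z"
  using lyap_linear[of c z] mult_nonneg_nonneg[of c "real s"] unfolding right_diff_distrib by linarith

text \<open>A step releases drift proportional to the previous value, so the compensating total
  excludes the newest one; without it the total is just \<open>s\<close>.\<close>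

lemma lyapunov_step:
  assumes "0 \<le> c"
  shows "(\<integral>\<^sup>+z. ennreal (c * (real (s + z) - real z) + lyap z) \<partial>cookie_lefts p r) = 
    ennreal (c * real s + (real r ^ 2 + 3 * real r))"
proof -
  have "(\<integral>\<^sup>+z. ennreal (c * (real (s + z) - real z) + lyap z) \<partial>cookie_lefts p r) =
    (\<integral>\<^sup>+z. ennreal (c * real s) + ennreal (lyap z) \<partial>cookie_lefts p r)"
    using assms lyap_nonneg by (intro nn_integral_cong) (simp add: ennreal_plus)
  also have "\<dots> = ennreal (c * real s) + ennreal (real r ^ 2 + 3 * real r)"
    using cookie_lefts_quadratic[of r] by (simp only: nn_integral_add lyap_def nn_integral_const measure_pmf.emeasure_space_1 borel_measurable_count_space measurable_pmf_measure1 mult_1_right)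
       (simp add: nn_integral_add)
  finally show ?thesis using assms by (simp add: ennreal_plus)
qed

text \<open>With \<open>Suc z\<close> right jumps due, \<open>lyap\<close> has mean
  \<open>lyap z + 4 - (2 * \<mu> - 6) * z\<close>; adding the total with the same coefficient
  cancels the linear term.\<close>

lemma sum_chain_lyapunov:
  "(\<integral>\<^sup>+w. ennreal ((2 * \<mu> - 6) * (real (snd w) - real (fst w)) + lyap (fst w)) \<partial>sum_chain p (0, 0) n) = ennreal (4 * real n)"
proof (induction n)
  case 0
  then show ?case by (simp add: lyap_def)
next
  case (Suc n)
  have c: "0 \<le> 2 * \<mu> - 6" "2 * \<mu> - 6 \<le> 2 * \<mu> - 1" using mu_gt_3 by auto
  let ?f = "\<lambda>w. (2 * \<mu> - 6) * (real (snd w) - real (fst w)) + lyap (fst w)"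
  have "(\<integral>\<^sup>+w. ennreal (?f w) \<partial>sum_chain p (0, 0) (Suc n)) = 
    (\<integral>\<^sup>+w. ennreal ((2 * \<mu> - 6) * real (snd w) + (real (Suc (fst w)) ^ 2 + 3 * real (Suc (fst w)))) \<partial>sum_chain p (0, 0) n)"
    unfolding nn_integral_sum_chain_Suc by (simp only: lyapunov_step[OF c(1)] fst_conv snd_conv)
  also have "(\<lambda>w. (2 * \<mu> - 6) * real (snd w) + (real (Suc (fst w)) ^ 2 + 3 * real (Suc (fst w)))) = (\<lambda>w. ?f w + 4)"
    by (simp add: fun_eq_iff lyap_def power2_eq_square algebra_simps)
  also have "(\<integral>\<^sup>+w. ennreal (?f w + 4) \<partial>sum_chain p (0, 0) n) = 
     (\<integral>\<^sup>+w. ennreal (?f w) \<partial>sum_chain p (0, 0) n) + 4"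
    using lyapunov_nonneg[OF c] by (simp add: ennreal_plus nn_integral_add)
  also have "\<dots> = ennreal (4 * real n) + 4" unfolding Suc ..
  also have "\<dots> = ennreal (4 * real (Suc n))" by (simp flip: ennreal_plus ennreal_numeral)
  finally show ?case .
qed

text \<open>Left of the start only \<open>z\<close> right jumps are due: the drift is
  \<open>- (2 * \<mu> - 4) * z\<close> with no constant term, so the compensated sum keeps its
  mean.\<close>

lemma blank_chain_lyapunov:
  assumes "n \<le> N"
  shows "(\<integral>\<^sup>+w. ennreal ((2 * \<mu> - 4) * (real (snd w) - real (fst w)) + lyap (fst w)) \<partial>blank_chain p n b N) =
   (\<integral>\<^sup>+w. ennreal ((2 * \<mu> - 4) * (real (snd w) - real (fst w)) + lyap (fst w)) \<partial>sum_chain p (0, 0) n)"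
  using assms
proof (induction N rule: dec_induct)
  case base
  then show ?case by (simp only: blank_chain_eq_sum_chain)
next
  case (step k)
  have c: "0 \<le> 2 * \<mu> - 4" using mu_gt_3 by auto
  have "(2 * \<mu> - 4) * real (snd w) + (real (fst w) ^ 2 + 3 * real (fst w)) = 
     (2 * \<mu> - 4) * (real (snd w) - real (fst w)) + lyap (fst w)" for w :: "nat \<times> nat"
    by (simp add: lyap_def power2_eq_square algebra_simps)
  moreover have "fst w + of_bool (k < n) = fst w" for w :: "nat \<times> nat" using step.hyps by simp
  ultimately show ?case
    using step.IH unfolding nn_integral_blank_chain_Suc
    by (simp only: lyapunov_step[OF c] fst_conv snd_conv)
qed

text \<open>A crude bound that discards the negative drift; it serves integrability and
  \<open>sum_chain_square\<close>.\<close>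

lemma sum_chain_lyap: "(\<integral>\<^sup>+w. ennreal (lyap (fst w)) \<partial>sum_chain p (0, 0) n) \<le> ennreal (4 * real n)"
proof (induction n)
  case 0
  then show ?case by (simp add: lyap_def)
next
  case (Suc n)
  have "(\<integral>\<^sup>+w. ennreal (lyap (fst w)) \<partial>sum_chain p (0, 0) (Suc n)) = 
    (\<integral>\<^sup>+w. ennreal (real (Suc (fst w)) ^ 2 + 3 * real (Suc (fst w))) \<partial>sum_chain p (0, 0) n)"
    unfolding nn_integral_sum_chain_Suc fst_conv lyap_def by (simp only: cookie_lefts_quadratic)
  also have "\<dots> \<le> (\<integral>\<^sup>+w. ennreal (lyap (fst w) + 4) \<partial>sum_chain p (0, 0) n)"
  proof (intro nn_integral_mono ennreal_leI)
    fix w :: "nat \<times> nat"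
    have "5 * real (fst w) \<le> (2 * \<mu> - 1) * real (fst w)" using mu_gt_3 by (intro mult_right_mono) auto
    then show "real (Suc (fst w)) ^ 2 + 3 * real (Suc (fst w)) \<le> lyap (fst w) + 4"
      by (simp add: lyap_def power2_eq_square algebra_simps)
  qed
  also have "\<dots> = (\<integral>\<^sup>+w. ennreal (lyap (fst w)) \<partial>sum_chain p (0, 0) n) + 4"
    using lyap_nonneg by (simp add: ennreal_plus nn_integral_add)
  also have "\<dots> \<le> ennreal (4 * real n) + 4" using Suc by (rule add_right_mono)
  also have "\<dots> = ennreal (4 * real (Suc n))" by (simp flip: ennreal_plus ennreal_numeral)
  finally show ?case .
qed

lemma sum_chain_square: "(\<integral>\<^sup>+w. ennreal (real (snd w) ^ 2) \<partial>sum_chain p (0, 0) n) \<le> ennreal (4 * real n ^ 3)"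
proof (induction n)
  case 0
  then show ?case by simp
next
  case (Suc n)
  have z2: "(\<integral>\<^sup>+w. ennreal (real (fst w) ^ 2) \<partial>sum_chain p (0, 0) (Suc n)) \<le> ennreal (4 * real (Suc n))"
    by (rule order_trans[OF nn_integral_mono sum_chain_lyap]) (use lyap_square in \<open>auto intro: ennreal_leI\<close>)
  show ?case
  proof (cases "n = 0")
    case True
    have "(\<integral>\<^sup>+w. ennreal (real (snd w) ^ 2) \<partial>sum_chain p (0, 0) (Suc n)) =
      (\<integral>\<^sup>+w. ennreal (real (fst w) ^ 2) \<partial>sum_chain p (0, 0) (Suc n))"
      using True by (simp add: sum_step_def bind_return_pmf)
    then show ?thesis using z2 True by simp
  next
    case False
    \<comment> \<open>The weights suit an old total about \<open>n\<close> times the new summand in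
      square mean: 4 n^3 against a bound of order 4 n.\<close>
    let ?a = "1 + 1 / real n" and ?b = "1 + real n"
    have "real (snd w + z) ^ 2 \<le> ?a * real (snd w) ^ 2 + ?b * real z ^ 2" for w :: "nat \<times> nat" and z
    proof -
      have "0 \<le> (real (snd w) / sqrt (real n) - sqrt (real n) * real z) ^ 2" by simp
      also have "\<dots> = real (snd w) ^ 2 / real n - 2 * real (snd w) * real z + real n * real z ^ 2"
        using False by (simp add: power2_diff power_mult_distrib power_divide)
      finally show ?thesis by (simp add: power2_sum algebra_simps)
    qed
    then have "(\<integral>\<^sup>+w. ennreal (real (snd w) ^ 2) \<partial>sum_chain p (0, 0) (Suc n)) \<le>
      (\<integral>\<^sup>+w. (\<integral>\<^sup>+z. ennreal ?a * ennreal (real (snd w) ^ 2) + ennreal ?b * ennreal (real z ^ 2) 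
        \<partial>cookie_lefts p (Suc (fst w))) \<partial>sum_chain p (0, 0) n)"
      unfolding nn_integral_sum_chain_Suc snd_conv
      by (intro nn_integral_mono) (simp flip: ennreal_mult ennreal_plus)
    also have "\<dots> = ennreal ?a * (\<integral>\<^sup>+w. ennreal (real (snd w) ^ 2) \<partial>sum_chain p (0, 0) n) + 
       ennreal ?b * (\<integral>\<^sup>+w. ennreal (real (fst w) ^ 2) \<partial>sum_chain p (0, 0) (Suc n))"
      unfolding nn_integral_sum_chain_Suc fst_conv by (simp add: nn_integral_add nn_integral_cmult)
    also have "\<dots> \<le> ennreal ?a * ennreal (4 * real n ^ 3) + ennreal ?b * ennreal (4 * real (Suc n))"
      using Suc z2 by (intro add_mono mult_left_mono) auto
    also have "\<dots> = ennreal (?a * (4 * real n ^ 3) + ?b * (4 * real (Suc n)))"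
      by (simp flip: ennreal_mult ennreal_plus)
    also have "?a * (4 * real n ^ 3) + ?b * (4 * real (Suc n)) \<le> 4 * real (Suc n) ^ 3"
      using False by (simp add: field_simps power2_eq_square power3_eq_cube)
    finally show ?thesis by (simp add: ennreal_leI)
  qed
qed

text \<open>Raising the exponent from 2 to 2 + \<delta> costs \<delta> (2 \<mu> + 6), chosen as half
  of the drift 2 \<mu> - 6. \<open>\<kappa>\<close> collects the constant terms, with 16 bounding 15
  + 1/r; \<open>\<Lambda>\<close> bounds what the drift cannot absorb at small r.\<close>

private definition "\<delta> = (\<mu> - 3) / (2 * \<mu> + 6)"
private definition "\<kappa> = (1 - \<delta>) * ((2 * \<mu> - 1) * (\<mu> - 1)) + 16 * \<delta>"
private definition "\<Lambda> = 2 * \<kappa> ^ 2 / (\<mu> - 3)"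

private lemma \<delta>: "0 < \<delta>" "\<delta> < 1" "\<delta> * (2 * \<mu> + 6) = \<mu> - 3"
  using mu_gt_3 by (auto simp: \<delta>_def)

private lemma \<kappa>: "0 \<le> \<kappa>" 
  using \<delta> mu_gt_3 by (auto simp: \<kappa>_def)

private lemma \<Lambda>: "0 \<le> \<Lambda>" 
  using mu_gt_3 by (auto simp: \<Lambda>_def)

text \<open>Of the drift \<mu> - 3 left over by the choice of \<delta>, one half absorbs the
  \<open>\<kappa>\<close> term except when r is below 2 \<kappa> / (\<mu> - 3); the other half stays
  on the left-hand side.\<close>

lemma cookie_lefts_powr_bound:
  assumes r: "r = real (Suc j)"
  shows "(\<integral>\<^sup>+z. ennreal (real z powr (2 + \<delta>)) \<partial>cookie_lefts p (Suc j)) + ennreal ((\<mu> - 3) / 2 * r powr (1 + \<delta>))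
    \<le> ennreal (real j powr (2 + \<delta>) + \<Lambda>)"
proof -
  have r1: "1 \<le> r" using r by simp
  define g where "g = r ^ 2 - (2 * \<mu> - 4) * r + (2 * \<mu> - 1) * (\<mu> - 1)"
  have g: "(\<integral>\<^sup>+z. ennreal (real z ^ 2) \<partial>cookie_lefts p (Suc j)) \<le> ennreal g" "0 \<le> g"
    using cookie_lefts_square_bound[of "Suc j"] by (simp_all only: g_def r)
  define c3 where "c3 = r ^ 3 + 9 * r ^ 2 + 15 * r + 1"
  have c3: "(\<integral>\<^sup>+z. ennreal (real z ^ 3) \<partial>cookie_lefts p (Suc j)) \<le> ennreal c3" "0 \<le> c3"
    using cookie_lefts_cube[of p "Suc j"] p r1 by (simp_all only: c3_def r) auto
  let ?a = "r powr \<delta> * (1 - \<delta>)" and ?b = "r powr \<delta> * (\<delta> / r)"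
  have ab: "0 \<le> ?a" "0 \<le> ?b" using \<delta> r1 by auto
  have "(\<integral>\<^sup>+z. ennreal (real z powr (2 + \<delta>)) \<partial>cookie_lefts p (Suc j)) \<le>
    (\<integral>\<^sup>+z. ennreal ?a * ennreal (real z ^ 2) + ennreal ?b * ennreal (real z ^ 3) \<partial>cookie_lefts p (Suc j))"
  proof (intro nn_integral_mono)
    fix z :: nat
    have "real z powr (2 + \<delta>) \<le> ?a * real z ^ 2 + ?b * real z ^ 3"
      using powr_cubic_bound[of "real z" r \<delta>] \<delta> r1 by (simp add: algebra_simps)
    then show "ennreal (real z powr (2 + \<delta>)) \<le> ennreal ?a * ennreal (real z ^ 2) + ennreal ?b * ennreal (real z ^ 3)"
      by (subst ennreal_lincomb[symmetric]) (use ab in \<open>auto intro: ennreal_leI\<close>)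
  qed
  also have "\<dots> = ennreal ?a * (\<integral>\<^sup>+z. ennreal (real z ^ 2) \<partial>cookie_lefts p (Suc j)) + 
      ennreal ?b * (\<integral>\<^sup>+z. ennreal (real z ^ 3) \<partial>cookie_lefts p (Suc j))"
    by (simp add: nn_integral_add nn_integral_cmult del: cookie_lefts.simps)
  also have "\<dots> \<le> ennreal ?a * ennreal g + ennreal ?b * ennreal c3"
    by (intro add_mono mult_left_mono g c3) auto
  also have "\<dots> = ennreal (?a * g + ?b * c3)"
    by (rule ennreal_lincomb[symmetric]) (fact ab g c3)+
  finally have 1: "(\<integral>\<^sup>+z. ennreal (real z powr (2 + \<delta>)) \<partial>cookie_lefts p (Suc j)) \<le> ennreal (?a * g + ?b * c3)" .
  have "\<delta> / r * c3 = \<delta> * (r ^ 2 + 9 * r + 15 + 1 / r)"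
    using r1 by (simp add: c3_def field_simps power2_eq_square power3_eq_cube)
  also have "\<dots> \<le> \<delta> * (r ^ 2 + 9 * r + 16)" using \<delta> r1 by (intro mult_left_mono) auto
  finally have "(1 - \<delta>) * g + \<delta> / r * c3 \<le> r ^ 2 - (2 * \<mu> - 4 - \<delta> * (2 * \<mu> + 5)) * r + \<kappa>"
    by (simp add: g_def \<kappa>_def algebra_simps)
  also have "\<dots> = r ^ 2 - (\<mu> - 1 + \<delta>) * r + \<kappa>" 
  proof -
    have "2 * \<mu> - 4 - \<delta> * (2 * \<mu> + 5) = \<mu> - 1 + \<delta>" using \<delta>(3) by (simp add: algebra_simps)
    then show ?thesis by simp
  qed
  finally have "r powr \<delta> * ((1 - \<delta>) * g + \<delta> / r * c3) \<le> r powr \<delta> * (r ^ 2 - (\<mu> - 1 + \<delta>) * r + \<kappa>)"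
    by (intro mult_left_mono) auto
  also have "\<dots> = r powr (2 + \<delta>) - (\<mu> - 1 + \<delta>) * r powr (1 + \<delta>) + \<kappa> * r powr \<delta>"
    using r1 by (simp add: powr_add algebra_simps)
  also have "r powr (2 + \<delta>) \<le> real j powr (2 + \<delta>) + (2 + \<delta>) * r powr (1 + \<delta>)"
    using powr_Suc_le[of "2 + \<delta>" j] \<delta> by (simp add: r)
  also have "\<kappa> * r powr \<delta> \<le> (\<mu> - 3) / 2 * r powr (1 + \<delta>) + \<Lambda>"
  proof (cases "\<kappa> \<le> (\<mu> - 3) / 2 * r")
    case True
    have "\<kappa> * r powr \<delta> \<le> (\<mu> - 3) / 2 * r * r powr \<delta>" using True by (intro mult_right_mono) auto
    also have "\<dots> = (\<mu> - 3) / 2 * r powr (1 + \<delta>)" using r1 by (simp add: powr_add)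
    finally show ?thesis using \<Lambda> by simp
  next
    case False
    have "r powr \<delta> \<le> r powr 1" using r1 \<delta> by (intro powr_mono) auto
    then have "r powr \<delta> \<le> r" using r1 by simp
    also have "r \<le> 2 * \<kappa> / (\<mu> - 3)" using False mu_gt_3 by (simp add: field_simps)
    finally have "\<kappa> * r powr \<delta> \<le> \<kappa> * (2 * \<kappa> / (\<mu> - 3))" using \<kappa> by (intro mult_left_mono)
    also have "\<dots> = \<Lambda>" by (simp add: \<Lambda>_def power2_eq_square)
    finally show ?thesis using mu_gt_3 by (simp add: add_increasing)
  qed
  finally have fin: "r powr \<delta> * ((1 - \<delta>) * g + \<delta> / r * c3) \<le> real j powr (2 + \<delta>) + (2 + \<delta>) * r powr (1 + \<delta>)
      - (\<mu> - 1 + \<delta>) * r powr (1 + \<delta>) + ((\<mu> - 3) / 2 * r powr (1 + \<delta>) + \<Lambda>)" by simp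
  have "(2 + \<delta>) * Q - (\<mu> - 1 + \<delta>) * Q + (\<mu> - 3) / 2 * Q = - ((\<mu> - 3) / 2 * Q)" for Q
    by (simp add: field_simps)
  from this[of "r powr (1 + \<delta>)"] fin have "?a * g + ?b * c3 + (\<mu> - 3) / 2 * r powr (1 + \<delta>) \<le> real j powr (2 + \<delta>) + \<Lambda>"
    by (simp only: distrib_left mult.assoc)
  moreover have "0 \<le> ?a * g + ?b * c3"
    by (intro add_nonneg_nonneg mult_nonneg_nonneg[OF ab(1) g(2)] mult_nonneg_nonneg[OF ab(2) c3(2)])
  moreover have "0 \<le> (\<mu> - 3) / 2 * r powr (1 + \<delta>)"
    using mu_gt_3 by auto
  ultimately have "ennreal (?a * g + ?b * c3) + ennreal ((\<mu> - 3) / 2 * r powr (1 + \<delta>)) \<le> ennreal (real j powr (2 + \<delta>) + \<Lambda>)"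
    by (simp flip: ennreal_plus add: ennreal_leI)
  with 1 show ?thesis by (meson add_right_mono order_trans)
qed

abbreviation (input) "moment a n \<equiv> (\<integral>\<^sup>+w. ennreal (real (fst w) powr a) \<partial>sum_chain p (0, 0) n)"

text \<open>The drift inequality telescopes, and the retained half of the drift controls the sum of
  the moments of order 1 + \<delta>.\<close>

lemma moment_sum_bound:
  "moment (2 + \<delta>) n + ennreal ((\<mu> - 3) / 2) * (\<Sum>k<n. moment (1 + \<delta>) k) \<le> ennreal (\<Lambda> * real n)"
proof (induction n)
  case 0
  then show ?case by simp
next
  case (Suc n)
  let ?c = "(\<mu> - 3) / 2"
  have "moment (2 + \<delta>) (Suc n) + ennreal ?c * moment (1 + \<delta>) n \<le>
     (\<integral>\<^sup>+w. (\<integral>\<^sup>+z. ennreal (real z powr (2 + \<delta>)) \<partial>cookie_lefts p (Suc (fst w))) +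
        ennreal (?c * real (Suc (fst w)) powr (1 + \<delta>)) \<partial>sum_chain p (0, 0) n)"
  proof -
    have "ennreal ?c * moment (1 + \<delta>) n \<le> (\<integral>\<^sup>+w. ennreal (?c * real (Suc (fst w)) powr (1 + \<delta>)) \<partial>sum_chain p (0, 0) n)"
      using mu_gt_3 \<delta> by (subst nn_integral_cmult[symmetric]) 
        (auto intro!: nn_integral_mono ennreal_leI mult_left_mono powr_mono2 simp flip: ennreal_mult simp del: of_nat_Suc)
    then show ?thesis
      unfolding nn_integral_sum_chain_Suc fst_conv 
      by (subst nn_integral_add) (auto intro: add_left_mono)
  qed
  also have "\<dots> \<le> (\<integral>\<^sup>+w. ennreal (real (fst w) powr (2 + \<delta>) + \<Lambda>) \<partial>sum_chain p (0, 0) n)"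
    by (intro nn_integral_mono cookie_lefts_powr_bound refl)
  also have "\<dots> = moment (2 + \<delta>) n + ennreal \<Lambda>"
    using \<Lambda> by (simp add: ennreal_plus nn_integral_add)
  finally have "moment (2 + \<delta>) (Suc n) + ennreal ?c * moment (1 + \<delta>) n + ennreal ?c * (\<Sum>k<n. moment (1 + \<delta>) k)
     \<le> moment (2 + \<delta>) n + ennreal \<Lambda> + ennreal ?c * (\<Sum>k<n. moment (1 + \<delta>) k)"
    by (rule add_right_mono)
  also have "\<dots> \<le> ennreal \<Lambda> + ennreal (\<Lambda> * real n)"
    using add_left_mono[OF Suc, of "ennreal \<Lambda>"] by (simp only: add_ac)
  also have "\<dots> = ennreal (\<Lambda> * real (Suc n))"
    using \<Lambda> by (simp flip: ennreal_plus add: algebra_simps)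
  finally show ?case by (simp add: distrib_left add_ac)
qed

text \<open>Moments of the chain started at \<open>0\<close> increase in time, so a bound on their averages is a bound on
  each of them.\<close>

lemma moment_low_bound:
  assumes "0 < n"
  shows "moment (1 + \<delta>) n \<le> ennreal (4 * \<Lambda> / (\<mu> - 3))"
proof -
  have mono: "moment (1 + \<delta>) j \<le> moment (1 + \<delta>) k" if "j \<le> k" for j k
    using p \<delta> by (intro sum_chain_moments_mono that) (auto simp: mono_def intro!: ennreal_leI powr_mono2)
  have "of_nat n * moment (1 + \<delta>) n = (\<Sum>k<n. moment (1 + \<delta>) n)" by simp
  also have "\<dots> \<le> (\<Sum>k<n. moment (1 + \<delta>) (n + k))" by (intro sum_mono mono) auto
  also have "\<dots> \<le> (\<Sum>k<n + n. moment (1 + \<delta>) k)"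
  proof -
    have "(\<Sum>k<n. moment (1 + \<delta>) (n + k)) = (\<Sum>k\<in>{n..<n + n}. moment (1 + \<delta>) k)"
      by (rule sum.reindex_bij_witness[of _ "\<lambda>k. k - n" "\<lambda>k. n + k"]) auto
    also have "\<dots> \<le> (\<Sum>k<n + n. moment (1 + \<delta>) k)" by (rule sum_mono2) auto
    finally show ?thesis .
  qed
  finally have "ennreal ((\<mu> - 3) / 2) * (of_nat n * moment (1 + \<delta>) n) \<le> 
      ennreal ((\<mu> - 3) / 2) * (\<Sum>k<n + n. moment (1 + \<delta>) k)" by (intro mult_left_mono) auto
  also have "\<dots> \<le> moment (2 + \<delta>) (n + n) + \<dots>" by simp
  also have "\<dots> \<le> ennreal (\<Lambda> * real (n + n))" by (rule moment_sum_bound)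
  finally have *: "ennreal ((\<mu> - 3) / 2) * (of_nat n * moment (1 + \<delta>) n) \<le> ennreal (\<Lambda> * real (n + n))" .
  show ?thesis
  proof (cases "moment (1 + \<delta>) n")
    case (real x)
    have "(\<mu> - 3) / 2 * (real n * x) \<le> \<Lambda> * real (n + n)"
      using * mu_gt_3 \<Lambda> real by (simp add: ennreal_of_nat_eq_real_of_nat flip: ennreal_mult)
    then have "(\<mu> - 3) * x * real n \<le> (4 * \<Lambda>) * real n" by (simp add: algebra_simps)
    then have "(\<mu> - 3) * x \<le> 4 * \<Lambda>" using assms by (simp add: mult_le_cancel_right)
    then show ?thesis unfolding real using mu_gt_3 by (intro ennreal_leI) (simp add: field_simps)
  next
    case top
    then show ?thesis using * assms mu_gt_3 by (simp add: ennreal_mult_top top_unique)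
  qed
qed

text \<open>Interpolation of z^2 between the powers 1 + \<delta>, of bounded mean, and 2 + \<delta>,
  of mean of order n, split at z = n. Sublinearity makes the boundary term of the mean identity
  negligible.\<close>

lemma sum_chain_lyap_bound:
  "\<exists>\<delta> C. 0 < \<delta> \<and> \<delta> < 1 \<and> 0 \<le> C \<and> (\<forall>n>0. (\<integral>\<^sup>+w. ennreal (lyap (fst w)) \<partial>sum_chain p (0, 0) n) \<le> ennreal (C * real n powr (1 - \<delta>)))"
proof (intro exI conjI allI impI)
  define C where "C = 2 * \<mu> * (4 * \<Lambda> / (\<mu> - 3) + \<Lambda>)"
  show "0 < \<delta>" "\<delta> < 1" by (fact \<delta>)+
  show "0 \<le> C" using \<Lambda> mu_gt_3 by (simp add: C_def)
  fix n :: nat assume n: "0 < n"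
  have pw: "lyap z \<le> 2 * \<mu> * (real n powr (1 - \<delta>) * real z powr (1 + \<delta>) + real n powr (- \<delta>) * real z powr (2 + \<delta>))" for z
  proof -
    have "real z ^ 2 \<le> real n powr (1 - \<delta>) * real z powr (1 + \<delta>) + real n powr (- \<delta>) * real z powr (2 + \<delta>)"
    proof (cases "z = 0")
      case False
      show ?thesis
      proof (cases "z \<le> n")
        case True
        have "real z ^ 2 = real z powr (1 - \<delta>) * real z powr (1 + \<delta>)" 
          using False by (simp flip: powr_add powr_numeral)
        also have "\<dots> \<le> real n powr (1 - \<delta>) * real z powr (1 + \<delta>)"
          using True \<delta> by (intro mult_right_mono powr_mono2) auto
        finally show ?thesis by (simp add: add_increasing2)
      next
        case nz: False
        have "real z ^ 2 = real z powr (- \<delta>) * real z powr (2 + \<delta>)" 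
          using False by (simp flip: powr_add powr_numeral)
        also have "\<dots> \<le> real n powr (- \<delta>) * real z powr (2 + \<delta>)"
          using nz n \<delta> by (intro mult_right_mono powr_mono2') auto
        finally show ?thesis by (simp add: add_increasing)
      qed
    qed simp
    then have "2 * \<mu> * real z ^ 2 \<le> 2 * \<mu> * (real n powr (1 - \<delta>) * real z powr (1 + \<delta>) + real n powr (- \<delta>) * real z powr (2 + \<delta>))"
      using mu_gt_3 by (intro mult_left_mono) auto
    with lyap_le[of z] show ?thesis by (rule order_trans)
  qed
  let ?a = "2 * \<mu> * real n powr (1 - \<delta>)" and ?b = "2 * \<mu> * real n powr (- \<delta>)"
  have "(\<integral>\<^sup>+w. ennreal (lyap (fst w)) \<partial>sum_chain p (0, 0) n) \<le> 
    (\<integral>\<^sup>+w. ennreal ?a * ennreal (real (fst w) powr (1 + \<delta>)) + ennreal ?b * ennreal (real (fst w) powr (2 + \<delta>)) \<partial>sum_chain p (0, 0) n)"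
  proof (intro nn_integral_mono)
    fix w :: "nat \<times> nat"
    have "lyap (fst w) \<le> ?a * real (fst w) powr (1 + \<delta>) + ?b * real (fst w) powr (2 + \<delta>)"
      using pw[of "fst w"] by (simp only: distrib_left mult.assoc)
    then have "ennreal (lyap (fst w)) \<le> ennreal (?a * real (fst w) powr (1 + \<delta>) + ?b * real (fst w) powr (2 + \<delta>))"
      by (rule ennreal_leI)
    also have "\<dots> = ennreal ?a * ennreal (real (fst w) powr (1 + \<delta>)) + ennreal ?b * ennreal (real (fst w) powr (2 + \<delta>))"
      by (rule ennreal_lincomb) (use mu_gt_3 in auto)
    finally show "ennreal (lyap (fst w)) \<le> ennreal ?a * ennreal (real (fst w) powr (1 + \<delta>)) + ennreal ?b * ennreal (real (fst w) powr (2 + \<delta>))" .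
  qed
  also have "\<dots> = ennreal ?a * moment (1 + \<delta>) n + ennreal ?b * moment (2 + \<delta>) n"
    by (simp add: nn_integral_add nn_integral_cmult)
  also have "\<dots> \<le> ennreal ?a * ennreal (4 * \<Lambda> / (\<mu> - 3)) + ennreal ?b * ennreal (\<Lambda> * real n)"
  proof (intro add_mono mult_left_mono moment_low_bound n)
    have "moment (2 + \<delta>) n \<le> moment (2 + \<delta>) n + ennreal ((\<mu> - 3) / 2) * (\<Sum>k<n. moment (1 + \<delta>) k)" by simp
    then show "moment (2 + \<delta>) n \<le> ennreal (\<Lambda> * real n)" using moment_sum_bound[of n] by (rule order_trans)
  qed auto
  also have "\<dots> = ennreal (?a * (4 * \<Lambda> / (\<mu> - 3)) + ?b * (\<Lambda> * real n))"
    by (rule ennreal_lincomb[symmetric]) (use mu_gt_3 \<Lambda> in auto)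
  also have "?b * (\<Lambda> * real n) = ?a * \<Lambda>"
    using n by (simp add: powr_diff powr_minus field_simps)
  also have "?a * (4 * \<Lambda> / (\<mu> - 3)) + ?a * \<Lambda> = C * real n powr (1 - \<delta>)"
    by (simp add: C_def algebra_simps)
  finally show "(\<integral>\<^sup>+w. ennreal (lyap (fst w)) \<partial>sum_chain p (0, 0) n) \<le> ennreal (C * real n powr (1 - \<delta>))" .
qed

text \<open>The \<open>ennreal\<close> identities as equations between finite real expectations,
  which can be solved for the mean of the total.\<close>

lemma sum_chain_expectations:
  fixes n :: nat
  defines "E \<equiv> measure_pmf.expectation (sum_chain p (0, 0) n)"
  shows "(2 * \<mu> - 6) * (E (\<lambda>w. real (snd w)) - E (\<lambda>w. real (fst w))) + E (\<lambda>w. lyap (fst w)) = 4 * real n"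
    "0 \<le> E (\<lambda>w. real (fst w))" "E (\<lambda>w. real (fst w)) \<le> E (\<lambda>w. lyap (fst w))"
    "(\<integral>\<^sup>+w. ennreal (lyap (fst w)) \<partial>sum_chain p (0, 0) n) = ennreal (E (\<lambda>w. lyap (fst w)))"
    "(\<integral>\<^sup>+w. ennreal ((2 * \<mu> - 4) * (real (snd w) - real (fst w)) + lyap (fst w)) \<partial>sum_chain p (0, 0) n)
      = ennreal ((2 * \<mu> - 4) * (E (\<lambda>w. real (snd w)) - E (\<lambda>w. real (fst w))) + E (\<lambda>w. lyap (fst w)))"
proof -
  let ?M = "sum_chain p (0, 0) n"
  have s: "integrable ?M (\<lambda>w. real (snd w))"
    using sum_chain_square[of n] by (intro integrable_of_square(2)) (auto simp: order_le_less_trans)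
  have "(\<integral>\<^sup>+w. ennreal (real (fst w) ^ 2) \<partial>?M) \<le> (\<integral>\<^sup>+w. ennreal (lyap (fst w)) \<partial>?M)"
    by (intro nn_integral_mono ennreal_leI lyap_square)
  also have "\<dots> < \<infinity>" using sum_chain_lyap[of n] by (auto simp: order_le_less_trans)
  finally have z2: "integrable ?M (\<lambda>w. real (fst w) ^ 2)" and z: "integrable ?M (\<lambda>w. real (fst w))"
    by (auto intro: integrable_of_square)
  have l: "integrable ?M (\<lambda>w. lyap (fst w))"
    unfolding lyap_def by (intro Bochner_Integration.integrable_add z2 integrable_mult_right z)
  have E: "(\<integral>\<^sup>+w. ennreal (c * (real (snd w) - real (fst w)) + lyap (fst w)) \<partial>?M) =
     ennreal (c * (E (\<lambda>w. real (snd w)) - E (\<lambda>w. real (fst w))) + E (\<lambda>w. lyap (fst w)))"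
    and E0: "0 \<le> c * (E (\<lambda>w. real (snd w)) - E (\<lambda>w. real (fst w))) + E (\<lambda>w. lyap (fst w))"
    if c: "0 \<le> c" "c \<le> 2 * \<mu> - 1" for c
  proof -
    have i: "integrable ?M (\<lambda>w. c * (real (snd w) - real (fst w)) + lyap (fst w))"
      by (intro Bochner_Integration.integrable_add Bochner_Integration.integrable_diff s z l integrable_mult_right)
    have e: "E (\<lambda>w. c * (real (snd w) - real (fst w)) + lyap (fst w)) = 
      c * (E (\<lambda>w. real (snd w)) - E (\<lambda>w. real (fst w))) + E (\<lambda>w. lyap (fst w))"
      unfolding E_def using s z l by simp
    have nn: "0 \<le> c * (real (snd w) - real (fst w)) + lyap (fst w)" for w :: "nat \<times> nat"
      by (rule lyapunov_nonneg[OF c])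
    show "(\<integral>\<^sup>+w. ennreal (c * (real (snd w) - real (fst w)) + lyap (fst w)) \<partial>?M) =
     ennreal (c * (E (\<lambda>w. real (snd w)) - E (\<lambda>w. real (fst w))) + E (\<lambda>w. lyap (fst w)))"
      using i nn unfolding e[symmetric] by (subst nn_integral_eq_integral) (auto simp: E_def)
    show "0 \<le> c * (E (\<lambda>w. real (snd w)) - E (\<lambda>w. real (fst w))) + E (\<lambda>w. lyap (fst w))"
      unfolding e[symmetric] unfolding E_def by (intro Bochner_Integration.integral_nonneg nn)
  qed
  have c6: "0 \<le> 2 * \<mu> - 6" "2 * \<mu> - 6 \<le> 2 * \<mu> - 1" and c4: "0 \<le> 2 * \<mu> - 4" "2 * \<mu> - 4 \<le> 2 * \<mu> - 1"
    using mu_gt_3 by auto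
  show "(2 * \<mu> - 6) * (E (\<lambda>w. real (snd w)) - E (\<lambda>w. real (fst w))) + E (\<lambda>w. lyap (fst w)) = 4 * real n"
    using E[OF c6] E0[OF c6] sum_chain_lyapunov[of n] by (metis ennreal_inj mult_nonneg_nonneg of_nat_0_le_iff zero_le_numeral)
  show "0 \<le> E (\<lambda>w. real (fst w))" unfolding E_def by simp
  show "E (\<lambda>w. real (fst w)) \<le> E (\<lambda>w. lyap (fst w))"
    unfolding E_def using lyap_linear[of 1] mu_gt_3 by (intro integral_mono z l) simp
  show "(\<integral>\<^sup>+w. ennreal (lyap (fst w)) \<partial>?M) = ennreal (E (\<lambda>w. lyap (fst w)))"
    unfolding E_def using l lyap_nonneg by (subst nn_integral_eq_integral) auto
  show "(\<integral>\<^sup>+w. ennreal ((2 * \<mu> - 4) * (real (snd w) - real (fst w)) + lyap (fst w)) \<partial>?M)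
      = ennreal ((2 * \<mu> - 4) * (E (\<lambda>w. real (snd w)) - E (\<lambda>w. real (fst w))) + E (\<lambda>w. lyap (fst w)))"
    by (rule E[OF c4])
qed

section \<open>Mean and tails of the number of left jumps before a hit\<close>

lemma blank_chain_integral_bounds:
  "\<exists>s D. 0 < s \<and> 0 \<le> D \<and> (\<forall>B N b. 0 < B \<longrightarrow> B ^ 4 \<le> N \<longrightarrow>
    (\<integral>\<^sup>+w. ennreal (max 0 (real (B ^ 4) * (2 / (\<mu> - 3)) - real (snd w))) \<partial>blank_chain p (B ^ 4) b N)
       \<le> ennreal (D * real (B ^ 4) * real B powr - s) \<and>
    (\<integral>\<^sup>+w. ennreal (real (snd w)) \<partial>blank_chain p (B ^ 4) b N)
       \<le> ennreal (real (B ^ 4) * (2 / (\<mu> - 3)) + D * real (B ^ 4) * real B powr - s))"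
proof -
  define m where "m = 2 / (\<mu> - 3)"
  have mu6: "(2 * \<mu> - 6) * m = 4" using mu_gt_3 by (simp add: m_def field_simps)
  obtain s C where s: "0 < s" "s < 1" and C: "0 \<le> C" and
    lyap_n: "\<And>n. 0 < n \<Longrightarrow> (\<integral>\<^sup>+w. ennreal (lyap (fst w)) \<partial>sum_chain p (0, 0) n) \<le> ennreal (C * real n powr (1 - s))"
    using sum_chain_lyap_bound by blast
  define El where "El n = measure_pmf.expectation (sum_chain p (0, 0) n) (\<lambda>w. lyap (fst w))" for n
  define Es where "Es n = measure_pmf.expectation (sum_chain p (0, 0) n) (\<lambda>w. real (snd w))" for n
  define Ez where "Ez n = measure_pmf.expectation (sum_chain p (0, 0) n) (\<lambda>w. real (fst w))" for n
  note Ex = sum_chain_expectations[folded El_def Es_def Ez_def]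
  have El: "El n \<le> C * real n powr (1 - s)" if "0 < n" for n
    using lyap_n[OF that] C unfolding Ex(4) by (subst (asm) ennreal_le_iff) auto
  have El0: "0 \<le> El n" for n using Ex(2,3)[of n] by linarith
  \<comment> \<open>The error \<open>real n * m - Es n\<close> equals
    \<open>El n / (2 * \<mu> - 6) - Ez n\<close>, where \<open>Ez n\<close> lies between 0 and
    \<open>El n\<close>.\<close>
  define A where "A = 1 / (2 * \<mu> - 6) + 1"
  have A: "0 \<le> A" using mu_gt_3 by (simp add: A_def)
  have mean: "\<bar>real n * m - Es n\<bar> \<le> A * El n" for n
  proof -
    have "(2 * \<mu> - 6) * (real n * m - Es n) = El n - (2 * \<mu> - 6) * Ez n"
    proof -
      have "(2 * \<mu> - 6) * (real n * m - Es n) = real n * ((2 * \<mu> - 6) * m) - (2 * \<mu> - 6) * Es n"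
        by (simp add: algebra_simps)
      then show ?thesis using Ex(1)[of n] unfolding mu6 right_diff_distrib[of _ "Es n"] by linarith
    qed
    then have "real n * m - Es n = El n / (2 * \<mu> - 6) - Ez n"
      using mu_gt_3 by (simp add: field_simps)
    moreover have "0 \<le> El n / (2 * \<mu> - 6)" using El0 mu_gt_3 by simp
    ultimately show ?thesis using Ex(2,3)[of n] by (simp add: A_def algebra_simps)
  qed
  \<comment> \<open>Squared bias, plus 4 from the variance, plus 1 from the summand \<theta> / 2,
    all halved.\<close>
  define D1 where "D1 = ((A * C) ^ 2 + 5) / 2"
  have D1: "0 \<le> D1" by (simp add: D1_def)
  show ?thesis
  proof (rule exI[of _ s], rule exI[of _ "D1 + C"], intro conjI allI impI)
    show "0 < s" "0 \<le> D1 + C" using s D1 C by auto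
    fix B N :: nat and b :: int assume B: "0 < B" and N: "B ^ 4 \<le> N"
    define \<beta> where "\<beta> = real B powr - s"
    define n where "n = B ^ 4"
    have n: "0 < n" using B by (simp add: n_def)
    have \<beta>: "0 < \<beta>" using B by (simp add: \<beta>_def)
    have B\<beta>: "real B powr (1 - s) = real B * \<beta>" using B by (simp add: \<beta>_def powr_diff powr_minus field_simps)
    have B\<beta>1: "1 \<le> real B * \<beta>" unfolding B\<beta>[symmetric] using B s by (intro ge_one_powr_ge_zero) auto
    have n\<beta>: "real n powr (1 - s) \<le> real n * \<beta>"
    proof -
      have "B ^ 1 \<le> B ^ 4" using B by (intro power_increasing) auto
      then have "real B \<le> real n" by (simp add: n_def flip: of_nat_power)
      then have "real n powr - s \<le> \<beta>" unfolding \<beta>_def using B s by (intro powr_mono2') auto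
      then have "real n * real n powr - s \<le> real n * \<beta>" by (intro mult_left_mono) auto
      then show ?thesis using n by (simp add: powr_diff powr_minus field_simps)
    qed
    have def: "(\<integral>\<^sup>+w. ennreal (max 0 (real n * m - real (snd w))) \<partial>sum_chain p (0, 0) n) \<le> ennreal (D1 * real n * \<beta>)"
    proof -
      let ?\<theta> = "real n * \<beta>"
      \<comment> \<open>With B^3 blocks of length B the variance is at most 4 B^6 and \<theta>^2 is
        B^8 \<beta>^2, so B \<beta> \<ge> 1 suffices. The bias, B^3 times a multiple of B \<beta>,
        is of order \<theta> too.\<close>
      have nB: "n = B ^ 3 * B" by (simp add: n_def power3_eq_cube power4_eq_xxxx)
      have "(\<integral>\<^sup>+w. ennreal (max 0 (real n * m - real (snd w))) \<partial>sum_chain p (0, 0) (B ^ 3 * B)) \<le> 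
         ennreal (((real n * m - real (B ^ 3) * Es B) ^ 2 + real (B ^ 3) * (4 * real B ^ 3)) / (2 * ?\<theta>) + ?\<theta> / 2)"
        unfolding Es_def using p n \<beta> by (intro sum_chain_deficit sum_chain_square) auto
      also have "\<dots> \<le> ennreal (D1 * real n * \<beta>)"
      proof (rule ennreal_leI)
        have "\<bar>real B * m - Es B\<bar> \<le> A * C * (real B * \<beta>)"
          using mean[of B] mult_left_mono[OF El[OF B] A] unfolding B\<beta> by simp
        then have "(real B * m - Es B) ^ 2 \<le> (A * C * (real B * \<beta>)) ^ 2"
          unfolding abs_le_square_iff[symmetric] using abs_ge_self order_trans by blast
        then have "(real B ^ 3) ^ 2 * (real B * m - Es B) ^ 2 \<le> (real B ^ 3) ^ 2 * (A * C * (real B * \<beta>)) ^ 2"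
          by (intro mult_left_mono) auto
        moreover have "(real n * m - real (B ^ 3) * Es B) ^ 2 = (real B ^ 3) ^ 2 * (real B * m - Es B) ^ 2"
          by (simp add: n_def algebra_simps power2_eq_square power3_eq_cube power4_eq_xxxx)
        moreover have "(real B ^ 3) ^ 2 * (A * C * (real B * \<beta>)) ^ 2 = (A * C) ^ 2 * ?\<theta> ^ 2"
          by (simp add: n_def algebra_simps power2_eq_square power3_eq_cube power4_eq_xxxx)
        moreover have "real (B ^ 3) * (4 * real B ^ 3) \<le> 4 * ?\<theta> ^ 2"
        proof -
          have "real (B ^ 3) * (4 * real B ^ 3) * 1 \<le> real (B ^ 3) * (4 * real B ^ 3) * (real B * \<beta>) ^ 2"
            using B\<beta>1 by (intro mult_left_mono) auto
          also have "\<dots> = 4 * ?\<theta> ^ 2"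
            by (simp add: n_def algebra_simps power2_eq_square power3_eq_cube power4_eq_xxxx)
          finally show ?thesis by simp
        qed
        ultimately have "(real n * m - real (B ^ 3) * Es B) ^ 2 + real (B ^ 3) * (4 * real B ^ 3) \<le> ((A * C) ^ 2 + 4) * ?\<theta> ^ 2"
          unfolding distrib_right by linarith
        then have "((real n * m - real (B ^ 3) * Es B) ^ 2 + real (B ^ 3) * (4 * real B ^ 3)) / (2 * ?\<theta>)
           \<le> ((A * C) ^ 2 + 4) * ?\<theta> ^ 2 / (2 * ?\<theta>)"
          using \<beta> by (intro divide_right_mono) auto
        also have "\<dots> = ((A * C) ^ 2 + 4) / 2 * ?\<theta>" using \<beta> n by (simp add: power2_eq_square)
        finally have fin: "((real n * m - real (B ^ 3) * Es B) ^ 2 + real (B ^ 3) * (4 * real B ^ 3)) / (2 * ?\<theta>)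
            \<le> ((A * C) ^ 2 + 4) / 2 * ?\<theta>" .
        show "((real n * m - real (B ^ 3) * Es B) ^ 2 + real (B ^ 3) * (4 * real B ^ 3)) / (2 * ?\<theta>) + ?\<theta> / 2
            \<le> D1 * real n * \<beta>"
        proof -
          have "D1 * real n * \<beta> = ((A * C) ^ 2 + 4) / 2 * ?\<theta> + ?\<theta> / 2"
            by (simp add: D1_def algebra_simps add_divide_distrib)
          then show ?thesis using fin by linarith
        qed
      qed
      finally show ?thesis unfolding nB .
    qed
    have "antimono (\<lambda>x. ennreal (max 0 (real n * m - real x)))"
      by (auto simp: antimono_def intro!: ennreal_leI)
    from nn_integral_antimono_blank_chain[OF this, of n N p b] N def
    have 1: "(\<integral>\<^sup>+w. ennreal (max 0 (real n * m - real (snd w))) \<partial>blank_chain p n b N) \<le> ennreal (D1 * real n * \<beta>)"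
      unfolding n_def by (meson order_trans)
    also have "\<dots> \<le> ennreal ((D1 + C) * real n * \<beta>)"
      using C \<beta> by (intro ennreal_leI mult_right_mono) auto
    finally show "(\<integral>\<^sup>+w. ennreal (max 0 (real (B ^ 4) * (2 / (\<mu> - 3)) - real (snd w))) \<partial>blank_chain p (B ^ 4) b N)
       \<le> ennreal ((D1 + C) * real (B ^ 4) * real B powr - s)" unfolding n_def m_def \<beta>_def .
    have c4: "0 < 2 * \<mu> - 4" "2 * \<mu> - 4 \<le> 2 * \<mu> - 1" using mu_gt_3 by auto
    have "ennreal (2 * \<mu> - 4) * (\<integral>\<^sup>+w. ennreal (real (snd w)) \<partial>blank_chain p n b N) =
       (\<integral>\<^sup>+w. ennreal ((2 * \<mu> - 4) * real (snd w)) \<partial>blank_chain p n b N)"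
      using c4 by (simp add: ennreal_mult nn_integral_cmult)
    \<comment> \<open>\<open>lyap\<close> at the last explored site pays for the value missing from
      the compensated sum; conservation left of the start then allows evaluation after only
      \<open>n\<close> sites.\<close>
    also have "\<dots> \<le> (\<integral>\<^sup>+w. ennreal ((2 * \<mu> - 4) * (real (snd w) - real (fst w)) + lyap (fst w)) \<partial>blank_chain p n b N)"
      using lyap_linear[OF c4(2)] by (intro nn_integral_mono ennreal_leI) (simp add: right_diff_distrib)
    also have "\<dots> = ennreal ((2 * \<mu> - 4) * (Es n - Ez n) + El n)"
      using N unfolding n_def[symmetric] by (simp only: blank_chain_lyapunov Ex(5))
    finally have *: "ennreal (2 * \<mu> - 4) * (\<integral>\<^sup>+w. ennreal (real (snd w)) \<partial>blank_chain p n b N)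
        \<le> ennreal ((2 * \<mu> - 4) * (Es n - Ez n) + El n)" .
    have "(2 * \<mu> - 6) * (Es n - Ez n) \<le> (2 * \<mu> - 6) * (real n * m)"
      using Ex(1)[of n] mu6 El0[of n] by (simp add: mult.left_commute)
    then have "Es n - Ez n \<le> real n * m" using mu_gt_3 by (simp add: mult_le_cancel_left)
    then have "(2 * \<mu> - 4) * (Es n - Ez n) + El n \<le> (2 * \<mu> - 4) * (real n * m) + El n"
      using c4 by (simp add: mult_le_cancel_left)
    also have "El n \<le> (2 * \<mu> - 4) * (C * (real n * \<beta>))"
    proof -
      have "El n \<le> 1 * (C * (real n * \<beta>))" using El[OF n] mult_left_mono[OF n\<beta> C] by simp
      also have "\<dots> \<le> (2 * \<mu> - 4) * (C * (real n * \<beta>))"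
        using mu_gt_3 C \<beta> by (intro mult_right_mono) auto
      finally show ?thesis .
    qed
    also have "C * (real n * \<beta>) \<le> (D1 + C) * real n * \<beta>"
      using D1 \<beta> by (simp add: algebra_simps)
    finally have "(2 * \<mu> - 4) * (Es n - Ez n) + El n \<le> (2 * \<mu> - 4) * (real n * m + (D1 + C) * real n * \<beta>)"
      using c4 by (simp add: distrib_left)
    then have "ennreal ((2 * \<mu> - 4) * (Es n - Ez n) + El n) \<le> ennreal (2 * \<mu> - 4) * ennreal (real n * m + (D1 + C) * real n * \<beta>)"
      using c4 mu_gt_3 D1 C \<beta> by (subst ennreal_mult[symmetric]) (auto intro!: ennreal_leI add_nonneg_nonneg mult_nonneg_nonneg simp: m_def)
    with * have "ennreal (2 * \<mu> - 4) * (\<integral>\<^sup>+w. ennreal (real (snd w)) \<partial>blank_chain p n b N)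
        \<le> ennreal (2 * \<mu> - 4) * ennreal (real n * m + (D1 + C) * real n * \<beta>)" by (rule order_trans)
    then have "(\<integral>\<^sup>+w. ennreal (real (snd w)) \<partial>blank_chain p n b N) \<le> ennreal (real n * m + (D1 + C) * real n * \<beta>)"
      using c4 by (subst (asm) ennreal_mult_le_mult_iff) auto
    then show "(\<integral>\<^sup>+w. ennreal (real (snd w)) \<partial>blank_chain p (B ^ 4) b N)
       \<le> ennreal (real (B ^ 4) * (2 / (\<mu> - 3)) + (D1 + C) * real (B ^ 4) * real B powr - s)"
      unfolding n_def m_def \<beta>_def .
  qed
qed

text \<open>The lower tail is Markov's inequality for the deficit. For the upper one, max(S, n m) is
  S plus the deficit, so its mean exceeds n m only slightly, and Markov's inequality applies to the
  excess.\<close>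

lemma blank_chain_tails:
  "\<exists>s D. 0 < s \<and> 0 \<le> D \<and> (\<forall>B N b \<epsilon>. 0 < B \<longrightarrow> B ^ 4 \<le> N \<longrightarrow> 0 < \<epsilon> \<longrightarrow>
    measure_pmf.prob (blank_chain p (B ^ 4) b N) {w. real (snd w) \<le> (2 / (\<mu> - 3) - \<epsilon>) * real (B ^ 4)}
       \<le> D / \<epsilon> * real B powr - s \<and>
    measure_pmf.prob (blank_chain p (B ^ 4) b N) {w. real (snd w) \<ge> (2 / (\<mu> - 3) + \<epsilon>) * real (B ^ 4)}
       \<le> D / \<epsilon> * real B powr - s)"
proof -
  define m where "m = 2 / (\<mu> - 3)"
  have m: "0 \<le> m" using mu_gt_3 by (simp add: m_def)
  obtain s D where s: "0 < s" and D: "0 \<le> D" and bd: "\<And>B N b. 0 < B \<Longrightarrow> B ^ 4 \<le> N \<Longrightarrow>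
    (\<integral>\<^sup>+w. ennreal (max 0 (real (B ^ 4) * m - real (snd w))) \<partial>blank_chain p (B ^ 4) b N)
       \<le> ennreal (D * real (B ^ 4) * real B powr - s) \<and>
    (\<integral>\<^sup>+w. ennreal (real (snd w)) \<partial>blank_chain p (B ^ 4) b N)
       \<le> ennreal (real (B ^ 4) * m + D * real (B ^ 4) * real B powr - s)"
    using blank_chain_integral_bounds unfolding m_def by blast
  show ?thesis unfolding m_def[symmetric]
  proof (rule exI[of _ s], rule exI[of _ "2 * D"], intro conjI allI impI)
    show "0 < s" "0 \<le> 2 * D" using s D by auto
    fix B N :: nat and b :: int and \<epsilon> :: real assume B: "0 < B" and N: "B ^ 4 \<le> N" and \<epsilon>: "0 < \<epsilon>"
    define \<beta> where "\<beta> = real B powr - s"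
    define n where "n = B ^ 4"
    let ?M = "blank_chain p n b N"
    have n: "0 < real n" and \<beta>: "0 < \<beta>" using B by (simp_all add: n_def \<beta>_def)
    from bd[OF B N, of b] have 1: "(\<integral>\<^sup>+w. ennreal (max 0 (real n * m - real (snd w))) \<partial>?M) \<le> ennreal (D * real n * \<beta>)"
      and 2: "(\<integral>\<^sup>+w. ennreal (real (snd w)) \<partial>?M) \<le> ennreal (real n * m + D * real n * \<beta>)"
      unfolding n_def \<beta>_def by auto
    let ?A = "{w. real (snd w) \<le> (m - \<epsilon>) * real n}" and ?A' = "{w. real (snd w) \<ge> (m + \<epsilon>) * real n}"
    have "ennreal (\<epsilon> * real n) * emeasure ?M ?A = (\<integral>\<^sup>+w. ennreal (\<epsilon> * real n) * indicator ?A w \<partial>?M)"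
      by (simp add: nn_integral_cmult)
    also have "\<dots> \<le> (\<integral>\<^sup>+w. ennreal (max 0 (real n * m - real (snd w))) \<partial>?M)"
      by (intro nn_integral_mono) (auto simp: indicator_def algebra_simps intro!: ennreal_leI)
    also note 1
    finally have "\<epsilon> * real n * measure_pmf.prob ?M ?A \<le> D * real n * \<beta>"
      using D n \<beta> \<epsilon> by (simp add: measure_pmf.emeasure_eq_measure flip: ennreal_mult)
    then have "\<epsilon> * measure_pmf.prob ?M ?A \<le> D * \<beta>" using n by (simp add: mult_ac)
    then have "measure_pmf.prob ?M ?A \<le> D * \<beta> / \<epsilon>" using \<epsilon> by (simp add: field_simps)
    also have "\<dots> \<le> 2 * D / \<epsilon> * \<beta>" using D \<beta> \<epsilon> by (simp add: field_simps)
    finally show "measure_pmf.prob (blank_chain p (B ^ 4) b N) {w. real (snd w) \<le> (m - \<epsilon>) * real (B ^ 4)}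
       \<le> 2 * D / \<epsilon> * real B powr - s" unfolding n_def \<beta>_def .
    have "ennreal (\<epsilon> * real n) * emeasure ?M ?A' + ennreal (real n * m) = 
      (\<integral>\<^sup>+w. ennreal (\<epsilon> * real n) * indicator ?A' w + ennreal (real n * m) \<partial>?M)"
      by (simp add: nn_integral_add nn_integral_cmult)
    also have "\<dots> \<le> (\<integral>\<^sup>+w. ennreal (real (snd w)) + ennreal (max 0 (real n * m - real (snd w))) \<partial>?M)"
    proof (rule nn_integral_mono)
      fix w :: "nat \<times> nat"
      have nm: "0 \<le> real n * m" using n m by simp
      have "\<epsilon> * real n * indicator ?A' w + real n * m \<le> real (snd w) + max 0 (real n * m - real (snd w))"
        using n by (auto simp: indicator_def algebra_simps)
      then have "ennreal (\<epsilon> * real n * indicator ?A' w + real n * m) \<le> ennreal (real (snd w) + max 0 (real n * m - real (snd w)))"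
        by (rule ennreal_leI)
      moreover have "ennreal (\<epsilon> * real n * indicator ?A' w + real n * m) = ennreal (\<epsilon> * real n) * indicator ?A' w + ennreal (real n * m)"
        using nm n \<epsilon> by (auto simp: indicator_def)
      ultimately show "ennreal (\<epsilon> * real n) * indicator ?A' w + ennreal (real n * m) \<le> 
          ennreal (real (snd w)) + ennreal (max 0 (real n * m - real (snd w)))" 
        by (simp add: ennreal_plus)
    qed
    also have "\<dots> = (\<integral>\<^sup>+w. ennreal (real (snd w)) \<partial>?M) + (\<integral>\<^sup>+w. ennreal (max 0 (real n * m - real (snd w))) \<partial>?M)"
      by (simp add: nn_integral_add)
    also have "\<dots> \<le> ennreal (real n * m + D * real n * \<beta>) + ennreal (D * real n * \<beta>)"
      by (intro add_mono 1 2)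
    finally have "\<epsilon> * real n * measure_pmf.prob ?M ?A' + real n * m \<le> real n * m + D * real n * \<beta> + D * real n * \<beta>"
      using D n \<beta> \<epsilon> m by (simp add: measure_pmf.emeasure_eq_measure flip: ennreal_mult ennreal_plus)
    then have "real n * (\<epsilon> * measure_pmf.prob ?M ?A') \<le> real n * (2 * D * \<beta>)" by (simp add: algebra_simps)
    then have "\<epsilon> * measure_pmf.prob ?M ?A' \<le> 2 * D * \<beta>" using n by (simp add: mult_le_cancel_left)
    then have "measure_pmf.prob ?M ?A' \<le> 2 * D / \<epsilon> * \<beta>" using \<epsilon> by (simp add: field_simps)
    then show "measure_pmf.prob (blank_chain p (B ^ 4) b N) {w. real (snd w) \<ge> (m + \<epsilon>) * real (B ^ 4)}
       \<le> 2 * D / \<epsilon> * real B powr - s" unfolding n_def \<beta>_def .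
  qed
qed

end

section \<open>From hitting times to the speed\<close>

context
  fixes x :: "nat \<Rightarrow> int" and a :: int and Q :: nat
  assumes x0: "x 0 = a" and nn: "\<And>t. \<bar>x (Suc t) - x t\<bar> = 1" and Q: "0 < Q"
begin

text \<open>Consecutive powers \<open>i ^ Q\<close> have ratio tending to 1, so the least checkpoint
  not before \<open>t\<close> overshoots by a factor close to 1.\<close>

lemma eventually_checkpoint:
  fixes \<kappa> \<delta> :: real
  assumes \<kappa>: "0 < \<kappa>" and \<delta>: "0 < \<delta>" and P: "\<forall>\<^sub>F i in sequentially. P i"
  shows "\<forall>\<^sub>F t in sequentially. \<exists>i. P i \<and> 0 < i \<and> real t \<le> \<kappa> * real (i ^ Q) \<and> \<kappa> * real (i ^ Q) \<le> (1 + \<delta>) * real t"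
proof -
  have "(\<lambda>i. (1 + 1 / real i) ^ Q) \<longlonglongrightarrow> (1 + 0) ^ Q"
    by (intro tendsto_intros lim_1_over_n)
  then have "(\<lambda>i. (1 + 1 / real i) ^ Q) \<longlonglongrightarrow> 1" by simp
  then have "\<forall>\<^sub>F i in sequentially. (1 + 1 / real i) ^ Q < 1 + \<delta>"
    using \<delta> by (intro order_tendstoD(2)[of _ 1]) auto
  with P obtain I where I: "\<And>i. I \<le> i \<Longrightarrow> P i \<and> (1 + 1 / real i) ^ Q < 1 + \<delta>"
    by (metis (mono_tags, lifting) eventually_conj eventually_sequentially)
  have "\<forall>\<^sub>F t in sequentially. \<kappa> * real ((I + 1) ^ Q) < real t"
    using filterlim_real_sequentially unfolding filterlim_at_top_dense by blast
  then show ?thesis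
  proof eventually_elim
    case (elim t)
    have "\<exists>i. real t \<le> \<kappa> * real (i ^ Q)"
    proof -
      obtain i :: nat where "real t / \<kappa> \<le> real i" using real_arch_simple by blast
      moreover have "i \<le> i ^ Q" using Q by (cases "i = 0") (auto simp: self_le_power)
      then have "real i \<le> real (i ^ Q)" by (simp only: of_nat_le_iff)
      ultimately have "real t / \<kappa> \<le> real (i ^ Q)" by linarith
      then show ?thesis using \<kappa> by (auto simp: field_simps)
    qed
    then obtain i where i: "real t \<le> \<kappa> * real (i ^ Q)" and least: "\<And>j. j < i \<Longrightarrow> \<not> real t \<le> \<kappa> * real (j ^ Q)"
      using exists_least_iff[of "\<lambda>i. real t \<le> \<kappa> * real (i ^ Q)"] by auto
    have "I + 1 < i"
    proof (rule ccontr)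
      assume "\<not> I + 1 < i"
      then have "real (i ^ Q) \<le> real ((I + 1) ^ Q)" by (simp only: of_nat_le_iff) (intro power_mono; simp)
      then have "\<kappa> * real (i ^ Q) \<le> \<kappa> * real ((I + 1) ^ Q)" using \<kappa> by (intro mult_left_mono) auto
      with i elim show False by linarith
    qed
    then obtain j where j: "i = Suc j" "I \<le> j" "0 < j" by (cases i) auto
    have "\<kappa> * real (j ^ Q) < real t" using least[of j] j by simp
    have "real i ^ Q = real j ^ Q * (1 + 1 / real j) ^ Q"
      using j by (simp add: power_mult_distrib[symmetric] field_simps)
    then have "\<kappa> * real (i ^ Q) = \<kappa> * real (j ^ Q) * (1 + 1 / real j) ^ Q" by simp
    also have "\<dots> \<le> \<kappa> * real (j ^ Q) * (1 + \<delta>)"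
      using I[OF j(2)] \<kappa> by (intro mult_left_mono) auto
    also have "\<dots> \<le> real t * (1 + \<delta>)"
      using \<open>\<kappa> * real (j ^ Q) < real t\<close> \<delta> by (intro mult_right_mono) auto
    finally show ?case using i I[of i] j by (intro exI[of _ i]) (auto simp: mult.commute)
  qed
qed

lemma below_checkpoint:
  assumes "\<And>k. k \<le> t \<Longrightarrow> x k \<noteq> a + int n" "0 < n"
  shows "x t < a + int n"
proof (rule ccontr)
  assume "\<not> x t < a + int n"
  then have "\<exists>i\<le>t. x i = a + int n"
    using nn x0 by (intro nat0_intermed_int_val) (auto simp: abs_if split: if_splits)
  then show False using assms by auto
qed

lemma increment_le: "x (t + k) \<le> x t + int k"
proof (induction k)
  case (Suc k)
  then show ?case using nn[of "t + k"] by simp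
qed simp

text \<open>A checkpoint not hit by time \<open>t\<close> still lies above the walk, which cannot
  jump over a level.\<close>

lemma speed_upper:
  fixes c \<epsilon> :: real
  assumes "0 < \<epsilon>" "\<epsilon> < c"
    and early: "\<forall>\<^sub>F i in sequentially. \<forall>k. real k \<le> (c - \<epsilon>) * real (i ^ Q) \<longrightarrow> x k \<noteq> a + int (i ^ Q)"
  shows "\<forall>\<^sub>F t in sequentially. real_of_int (x t - a) \<le> (1 + \<epsilon>) / (c - \<epsilon>) * real t"
proof -
  have "0 < c - \<epsilon>" using assms by simp
  from eventually_checkpoint[OF this assms(1) early] show ?thesis
  proof eventually_elim
    case (elim t)
    then obtain i where i: "\<And>k. real k \<le> (c - \<epsilon>) * real (i ^ Q) \<Longrightarrow> x k \<noteq> a + int (i ^ Q)"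
      "0 < i" "real t \<le> (c - \<epsilon>) * real (i ^ Q)" "(c - \<epsilon>) * real (i ^ Q) \<le> (1 + \<epsilon>) * real t" by blast
    have "x t < a + int (i ^ Q)"
    proof (rule below_checkpoint)
      fix k assume "k \<le> t"
      then show "x k \<noteq> a + int (i ^ Q)" using i(1)[of k] i(3) by simp
    qed (use i(2) in simp)
    then have "real_of_int (x t - a) \<le> real_of_int (int (i ^ Q))" by (simp only: of_int_le_iff)
    also have "real_of_int (int (i ^ Q)) \<le> (1 + \<epsilon>) / (c - \<epsilon>) * real t"
      using i(4) \<open>0 < c - \<epsilon>\<close> by (simp add: field_simps)
    finally show ?case .
  qed
qed

text \<open>The walk cannot be far behind at time \<open>t\<close> because it hits a level slightly above the maximum
  shortly afterwards.\<close>

lemma speed_lower: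
  fixes c \<epsilon> :: real
  assumes "0 < \<epsilon>" "\<epsilon> < c" "1 \<le> c"
    and early: "\<forall>\<^sub>F i in sequentially. \<forall>k. real k \<le> (c - \<epsilon>) * real (i ^ Q) \<longrightarrow> x k \<noteq> a + int (i ^ Q)"
    and late: "\<forall>\<^sub>F i in sequentially. \<exists>k. real k \<le> (c + \<epsilon>) * real (i ^ Q) \<and> x k = a + int (i ^ Q)"
  shows "\<forall>\<^sub>F t in sequentially. (1 - (c + \<epsilon> - 1) * (1 + \<epsilon>) / (c - \<epsilon>)) * real t \<le> real_of_int (x t - a)"
proof -
  have "0 < c - \<epsilon>" using assms by simp
  from eventually_checkpoint[OF this assms(1) eventually_conj[OF early late]] show ?thesis
  proof eventually_elim
    case (elim t)
    then obtain i \<tau> where i: "\<And>k. real k \<le> (c - \<epsilon>) * real (i ^ Q) \<Longrightarrow> x k \<noteq> a + int (i ^ Q)"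
      "real t \<le> (c - \<epsilon>) * real (i ^ Q)" "(c - \<epsilon>) * real (i ^ Q) \<le> (1 + \<epsilon>) * real t"
      and \<tau>: "real \<tau> \<le> (c + \<epsilon>) * real (i ^ Q)" "x \<tau> = a + int (i ^ Q)" by blast
    have "\<not> real \<tau> \<le> (c - \<epsilon>) * real (i ^ Q)" using i(1) \<tau>(2) by blast
    then have "t \<le> \<tau>" using i(2) by simp
    then have "a + int (i ^ Q) \<le> x t + int (\<tau> - t)" using increment_le[of t "\<tau> - t"] \<tau>(2) by simp
    then have "real_of_int (int (i ^ Q) + int t - int \<tau>) \<le> real_of_int (x t - a)"
      using \<open>t \<le> \<tau>\<close> by (simp only: of_int_le_iff)
    then have "real (i ^ Q) + real t - real \<tau> \<le> real_of_int (x t - a)" by simp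
    with \<tau>(1) have "real t - (c + \<epsilon> - 1) * real (i ^ Q) \<le> real_of_int (x t - a)"
      by (simp add: algebra_simps)
    moreover have "(c + \<epsilon> - 1) * real (i ^ Q) \<le> (c + \<epsilon> - 1) * ((1 + \<epsilon>) / (c - \<epsilon>) * real t)"
      using i(3) \<open>0 < c - \<epsilon>\<close> assms by (intro mult_left_mono) (simp_all add: field_simps)
    moreover have eq: "(1 - u * v / w) * r = r - u * (v / w * r)" for u v w r :: real
      by (simp add: algebra_simps)
    ultimately show ?case unfolding eq by linarith
  qed
qed

lemma tendsto_speed:
  assumes "\<And>e. 0 < e \<Longrightarrow> \<forall>\<^sub>F t in sequentially. (v - e) * real t \<le> real_of_int (x t - a)"
    and "\<And>e. 0 < e \<Longrightarrow> \<forall>\<^sub>F t in sequentially. real_of_int (x t - a) \<le> (v + e) * real t"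
  shows "(\<lambda>t. real_of_int (x t) / real t) \<longlonglongrightarrow> v"
proof -
  have "(\<lambda>t. real_of_int (x t - a) / real t) \<longlonglongrightarrow> v"
  proof (rule tendstoI)
    fix e :: real assume e: "0 < e"
    then have "0 < e / 2" by simp
    from assms(1)[OF this] assms(2)[OF this] eventually_gt_at_top[of 0]
    show "\<forall>\<^sub>F t in sequentially. dist (real_of_int (x t - a) / real t) v < e"
    proof eventually_elim
      case (elim t)
      then have "v - e / 2 \<le> real_of_int (x t - a) / real t" "real_of_int (x t - a) / real t \<le> v + e / 2"
        by (simp_all add: field_simps)
      then show ?case using e unfolding dist_real_def by linarith
    qed
  qed
  moreover have "(\<lambda>t. real_of_int a / real t) \<longlonglongrightarrow> 0" by (rule lim_const_over_n)
  ultimately have "(\<lambda>t. real_of_int (x t - a) / real t + real_of_int a / real t) \<longlonglongrightarrow> v + 0"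
    by (rule tendsto_add)
  then show ?thesis by (simp add: add_divide_distrib[symmetric])
qed

end

text \<open>The limiting ratio of hitting time to distance, the reciprocal of the speed.\<close>

definition time_per_site :: "real \<Rightarrow> real" where
  "time_per_site q = 1 / (4 * q - 3)"

lemma time_per_site_mu:
  assumes "3/4 < q" "q < 1" "\<mu> = q / (1 - q)"
  shows "time_per_site q = 1 + 2 * (2 / (\<mu> - 3))"
proof -
  have eq: "\<mu> - 3 = (4 * q - 3) / (1 - q)" using assms by (simp add: field_simps)
  show ?thesis unfolding eq time_per_site_def using assms(1,2) by (simp add: field_simps)
qed

text \<open>Taking \<open>B = i ^ m\<close> with \<open>m * s \<ge> 2\<close> makes the polynomial
  rate summable. The tolerance is halved because a hitting time contains the left jumps
  twice.\<close>

lemma checkpoint_tails: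
  assumes q: "3/4 < q" "q < 1"
  shows "\<exists>Q D. 0 < Q \<and> (\<forall>i N b \<epsilon>. 0 < i \<longrightarrow> i ^ Q \<le> N \<longrightarrow> 0 < \<epsilon> \<longrightarrow>
    measure_pmf.prob (blank_chain q (i ^ Q) b N) {w. real (i ^ Q + 2 * snd w) \<le> (time_per_site q - \<epsilon>) * real (i ^ Q)}
       \<le> D / \<epsilon> * (1 / real i ^ 2) \<and>
    measure_pmf.prob (blank_chain q (i ^ Q) b N) {w. real (i ^ Q + 2 * snd w) \<ge> (time_per_site q + \<epsilon>) * real (i ^ Q)}
       \<le> D / \<epsilon> * (1 / real i ^ 2))"
proof -
  define \<mu> where "\<mu> = q / (1 - q)"
  note c = time_per_site_mu[OF q \<mu>_def]
  obtain s D where s: "0 < s" and D: "0 \<le> D" and tails: "\<And>B N b \<epsilon>. 0 < B \<Longrightarrow> B ^ 4 \<le> N \<Longrightarrow> 0 < \<epsilon> \<Longrightarrow>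
    measure_pmf.prob (blank_chain q (B ^ 4) b N) {w. real (snd w) \<le> (2 / (\<mu> - 3) - \<epsilon>) * real (B ^ 4)}
       \<le> D / \<epsilon> * real B powr - s \<and>
    measure_pmf.prob (blank_chain q (B ^ 4) b N) {w. real (snd w) \<ge> (2 / (\<mu> - 3) + \<epsilon>) * real (B ^ 4)}
       \<le> D / \<epsilon> * real B powr - s"
    using blank_chain_tails[OF q \<mu>_def] by blast
  define m where "m = nat \<lceil>2 / s\<rceil>"
  have ms: "2 \<le> real m * s" and m: "0 < m"
  proof -
    have "2 / s \<le> real m" unfolding m_def by linarith
    then show "2 \<le> real m * s" using s by (simp add: field_simps)
    then show "0 < m" using s by (cases m) auto
  qed
  show ?thesis
  proof (rule exI[of _ "m * 4"], rule exI[of _ "2 * D"], intro conjI allI impI)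
    show "0 < m * 4" using m by simp
    fix i N :: nat and b :: int and \<epsilon> :: real
    assume i: "0 < i" and N: "i ^ (m * 4) \<le> N" and \<epsilon>: "0 < \<epsilon>"
    have pw: "real (i ^ m) powr - s \<le> 1 / real i ^ 2"
    proof -
      have "real (i ^ m) powr - s = real i powr (real m * - s)"
        using i by (simp add: powr_realpow[symmetric] powr_powr)
      also have "\<dots> \<le> real i powr - 2" using i ms by (intro powr_mono) auto
      also have "\<dots> = 1 / real i ^ 2" using i by (simp add: powr_minus divide_inverse)
      finally show ?thesis .
    qed
    let ?M = "blank_chain q (i ^ (m * 4)) b N"
    have "0 < i ^ m" "(i ^ m) ^ 4 \<le> N" "0 < \<epsilon> / 2" using i N \<epsilon> by (auto simp flip: power_mult)
    from tails[OF this, of b] have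
      1: "measure_pmf.prob ?M {w. real (snd w) \<le> (2 / (\<mu> - 3) - \<epsilon> / 2) * real (i ^ (m * 4))} \<le> D / (\<epsilon> / 2) * real (i ^ m) powr - s"
      and 2: "measure_pmf.prob ?M {w. real (snd w) \<ge> (2 / (\<mu> - 3) + \<epsilon> / 2) * real (i ^ (m * 4))} \<le> D / (\<epsilon> / 2) * real (i ^ m) powr - s"
      unfolding power_mult[symmetric] by auto
    have D': "D / (\<epsilon> / 2) * real (i ^ m) powr - s \<le> 2 * D / \<epsilon> * (1 / real i ^ 2)"
      using mult_left_mono[OF pw, of "2 * D / \<epsilon>"] D \<epsilon> by (simp add: mult.commute)
    have e: "real (n + 2 * k) \<le> (time_per_site q - \<epsilon>) * real n \<longleftrightarrow> real k \<le> (2 / (\<mu> - 3) - \<epsilon> / 2) * real n"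
      "real (n + 2 * k) \<ge> (time_per_site q + \<epsilon>) * real n \<longleftrightarrow> real k \<ge> (2 / (\<mu> - 3) + \<epsilon> / 2) * real n" for n k :: nat
    proof -
      define y where "y = 2 / (\<mu> - 3)"
      show "real (n + 2 * k) \<le> (time_per_site q - \<epsilon>) * real n \<longleftrightarrow> real k \<le> (2 / (\<mu> - 3) - \<epsilon> / 2) * real n"
        "real (n + 2 * k) \<ge> (time_per_site q + \<epsilon>) * real n \<longleftrightarrow> real k \<ge> (2 / (\<mu> - 3) + \<epsilon> / 2) * real n"
        unfolding c y_def[symmetric] by (auto simp: algebra_simps)
    qed
    show "measure_pmf.prob ?M {w. real (i ^ (m * 4) + 2 * snd w) \<le> (time_per_site q - \<epsilon>) * real (i ^ (m * 4))}
       \<le> 2 * D / \<epsilon> * (1 / real i ^ 2)" unfolding e using 1 D' by (rule order_trans)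
    show "measure_pmf.prob ?M {w. real (i ^ (m * 4) + 2 * snd w) \<ge> (time_per_site q + \<epsilon>) * real (i ^ (m * 4))}
       \<le> 2 * D / \<epsilon> * (1 / real i ^ 2)" unfolding e using 2 D' by (rule order_trans)
  qed
qed

lemma (in prob_space) AE_eventually_not:
  assumes meas: "\<And>i. A i \<in> sets M" and bd: "\<And>i. 0 < i \<Longrightarrow> prob (A i) \<le> D * (1 / real i ^ 2)"
  shows "AE s in M. \<forall>\<^sub>F i in sequentially. s \<notin> A i"
proof -
  have "summable (\<lambda>i. D * (1 / real i ^ 2))"
    using inverse_power_summable[of 2, where 'a = real] by (intro summable_mult) (simp add: divide_inverse)
  then have "summable (\<lambda>i. prob (A i))"
    by (rule summable_comparison_test'[of _ 1]) (use bd in auto)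
  then have "AE s in M. \<forall>\<^sub>F i in sequentially. s \<in> space M - A i"
    by (intro borel_cantelli_AE1 meas) (auto simp: less_top[symmetric])
  then show ?thesis by (auto elim: eventually_mono)
qed

section \<open>Almost sure behaviour of the walk\<close>

context
  fixes M :: "'a measure" and p :: real and a :: int and X :: "nat \<Rightarrow> 'a \<Rightarrow> int"
  assumes walk: "cookie_random_walk M (\<lambda>_. p) a X"
begin

interpretation cookie_random_walk M "\<lambda>_. p" a X by (rule walk)

lemma p_bounds: "1/2 \<le> p" "p < 1"
  using env by auto

lemma hit_sets: "{s \<in> space M. \<exists>k\<le>T. X k s = b} \<in> sets M"
proof -
  have [measurable]: "X i \<in> M \<rightarrow>\<^sub>M count_space UNIV" for i by (rule rv)
  show ?thesis by measurable
qed

text \<open>Weaker cookies only delay a hit, so tails for \<open>q\<close> serve every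
  \<open>p \<le> q\<close>: \<open>q = p\<close> in the ballistic case, \<open>q\<close> slightly
  above 3/4 otherwise.\<close>

lemma AE_not_early:
  assumes q: "3/4 < q" "q < 1" "p \<le> q" and Q: "0 < Q" and \<epsilon>: "0 < \<epsilon>" "\<epsilon> < time_per_site q" and
    tails: "\<And>i N b. 0 < i \<Longrightarrow> i ^ Q \<le> N \<Longrightarrow>
      measure_pmf.prob (blank_chain q (i ^ Q) b N) {w. real (i ^ Q + 2 * snd w) \<le> (time_per_site q - \<epsilon>) * real (i ^ Q)}
       \<le> D * (1 / real i ^ 2)"
  shows "AE s in M. \<forall>\<^sub>F i in sequentially. \<forall>k. real k \<le> (time_per_site q - \<epsilon>) * real (i ^ Q) \<longrightarrow> X k s \<noteq> a + int (i ^ Q)"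
proof -
  define T where "T i = nat \<lfloor>(time_per_site q - \<epsilon>) * real (i ^ Q)\<rfloor>" for i
  have T: "k \<le> T i \<longleftrightarrow> real k \<le> (time_per_site q - \<epsilon>) * real (i ^ Q)" for k i
    using \<epsilon> unfolding T_def by (subst le_nat_iff) (auto simp: le_floor_iff)
  define A where "A i = {s \<in> space M. \<exists>k\<le>T i. X k s = a + int (i ^ Q)}" for i
  have "AE s in M. \<forall>\<^sub>F i in sequentially. s \<notin> A i"
  proof (rule AE_eventually_not)
    show "A i \<in> sets M" for i unfolding A_def by (rule hit_sets)
    fix i :: nat assume i: "0 < i"
    let ?N = "i ^ Q + T i"
    have "prob (A i) = measure_pmf.prob (blank_chain p (i ^ Q) (a + int (i ^ Q)) ?N) {w. i ^ Q + 2 * snd w \<le> T i}"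
      unfolding A_def by (rule prob_hits[OF walk]) (use i in auto)
    also have "\<dots> \<le> measure_pmf.prob (blank_chain q (i ^ Q) (a + int (i ^ Q)) ?N) {w. i ^ Q + 2 * snd w \<le> T i}"
    proof -
      have "rel_pmf le2\<inverse>\<inverse> (blank_chain p (i ^ Q) (a + int (i ^ Q)) ?N) (blank_chain q (i ^ Q) (a + int (i ^ Q)) ?N)"
        unfolding pmf.rel_conversep using p_bounds q by (simp add: blank_chain_mono)
      from rel_pmf_measureD[OF this, of "{w. i ^ Q + 2 * snd w \<le> T i}"] show ?thesis
        by (rule order_trans) (auto intro!: measure_pmf.finite_measure_mono)
    qed
    also have "\<dots> \<le> D * (1 / real i ^ 2)"
      using tails[OF i, of ?N "a + int (i ^ Q)"] unfolding T by simp
    finally show "prob (A i) \<le> D * (1 / real i ^ 2)" .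
  qed
  with AE_space show ?thesis
    by eventually_elim (auto simp: A_def T elim!: eventually_mono)
qed

lemma AE_hit_in_time:
  assumes q: "3/4 < p" and Q: "0 < Q" and \<epsilon>: "0 < \<epsilon>" and
    tails: "\<And>i N b. 0 < i \<Longrightarrow> i ^ Q \<le> N \<Longrightarrow>
      measure_pmf.prob (blank_chain p (i ^ Q) b N) {w. real (i ^ Q + 2 * snd w) \<ge> (time_per_site p + \<epsilon>) * real (i ^ Q)}
       \<le> D * (1 / real i ^ 2)"
  shows "AE s in M. \<forall>\<^sub>F i in sequentially. \<exists>k. real k \<le> (time_per_site p + \<epsilon>) * real (i ^ Q) \<and> X k s = a + int (i ^ Q)"
proof -
  define T where "T i = nat \<lfloor>(time_per_site p + \<epsilon>) * real (i ^ Q)\<rfloor>" for i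
  have "0 < time_per_site p" using q by (simp add: time_per_site_def)
  then have T: "k \<le> T i \<longleftrightarrow> real k \<le> (time_per_site p + \<epsilon>) * real (i ^ Q)" for k i
    using \<epsilon> unfolding T_def by (subst le_nat_iff) (auto simp: le_floor_iff)
  define A where "A i = {s \<in> space M. \<exists>k\<le>T i. X k s = a + int (i ^ Q)}" for i
  have A: "A i \<in> sets M" for i unfolding A_def by (rule hit_sets)
  have "AE s in M. \<forall>\<^sub>F i in sequentially. s \<notin> space M - A i"
  proof (rule AE_eventually_not)
    show "space M - A i \<in> sets M" for i using A by auto
    fix i :: nat assume i: "0 < i"
    let ?N = "i ^ Q + T i"
    let ?B = "blank_chain p (i ^ Q) (a + int (i ^ Q)) ?N"
    have "prob (space M - A i) = 1 - prob (A i)" using A by (rule prob_compl)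
    also have "prob (A i) = measure_pmf.prob ?B {w. i ^ Q + 2 * snd w \<le> T i}"
      unfolding A_def by (rule prob_hits[OF walk]) (use i in auto)
    also have "1 - \<dots> = measure_pmf.prob ?B (UNIV - {w. i ^ Q + 2 * snd w \<le> T i})"
      using measure_pmf.prob_compl[of "{w. i ^ Q + 2 * snd w \<le> T i}" ?B] by simp
    also have "\<dots> \<le> measure_pmf.prob ?B {w. real (i ^ Q + 2 * snd w) \<ge> (time_per_site p + \<epsilon>) * real (i ^ Q)}"
      by (intro measure_pmf.finite_measure_mono) (auto simp: T)
    also have "\<dots> \<le> D * (1 / real i ^ 2)"
      using tails[OF i, of ?N "a + int (i ^ Q)"] by simp
    finally show "prob (space M - A i) \<le> D * (1 / real i ^ 2)" .
  qed
  with AE_space show ?thesis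
    by eventually_elim (auto simp: A_def T elim!: eventually_mono)
qed

text \<open>Every right probability is at least 1/2, and a symmetric step multiplies the exponential
  moment by exactly \<open>cosh l\<close>.\<close>

lemma cookie_walk_exp_moment:
  assumes "0 \<le> l"
  shows "(\<integral>\<^sup>+xs. ennreal (exp (- l * real_of_int (hd xs - a))) \<partial>cookie_walk p a t) \<le> ennreal (cosh l ^ t)"
proof (induction t)
  case 0
  then show ?case by simp
next
  case (Suc t)
  have "(\<integral>\<^sup>+ys. ennreal (exp (- l * real_of_int (hd ys - a))) \<partial>cookie_step p xs) \<le> 
     ennreal (cosh l) * ennreal (exp (- l * real_of_int (hd xs - a)))" for xs
  proof -
    define r where "r = (if left_jumps xs (hd xs) = 0 then p else 1/2)"
    define e where "e = exp (- l * real_of_int (hd xs - a))"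
    have r: "1/2 \<le> r" "r \<le> 1" using p_bounds by (auto simp: r_def)
    have "(\<integral>\<^sup>+ys. ennreal (exp (- l * real_of_int (hd ys - a))) \<partial>cookie_step p xs) =
      ennreal (e * exp (- l)) * ennreal r + ennreal (e * exp l) * ennreal (1 - r)"
      unfolding cookie_step_def r_def[symmetric] using r 
      by (simp add: e_def algebra_simps flip: exp_add)
    also have "\<dots> = ennreal (e * (exp (- l) * r + exp l * (1 - r)))"
      using r by (simp add: e_def algebra_simps flip: ennreal_mult ennreal_plus)
    also have "exp (- l) * r + exp l * (1 - r) \<le> cosh l"
    proof -
      have "exp (- l) \<le> exp l" using assms by simp
      then have "(r - 1/2) * exp (- l) \<le> (r - 1/2) * exp l" using r by (intro mult_left_mono) auto
      then show ?thesis by (simp add: cosh_def algebra_simps)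
    qed
    finally show ?thesis by (simp add: e_def ennreal_mult'[symmetric] mult.commute ennreal_leI)
  qed
  then have "(\<integral>\<^sup>+xs. ennreal (exp (- l * real_of_int (hd xs - a))) \<partial>cookie_walk p a (Suc t)) \<le>
     (\<integral>\<^sup>+xs. ennreal (cosh l) * ennreal (exp (- l * real_of_int (hd xs - a))) \<partial>cookie_walk p a t)"
    unfolding cookie_walk.simps nn_integral_bind_pmf by (intro nn_integral_mono)
  also have "\<dots> = ennreal (cosh l) * (\<integral>\<^sup>+xs. ennreal (exp (- l * real_of_int (hd xs - a))) \<partial>cookie_walk p a t)"
    by (simp add: nn_integral_cmult)
  also have "\<dots> \<le> ennreal (cosh l) * ennreal (cosh l ^ t)" by (intro mult_left_mono Suc) auto
  finally show ?case by (simp flip: ennreal_mult)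
qed

text \<open>The absence of early hits bounds the position only from above; this Chernoff bound
  supplies the other half for p < 3/4. The factor \<open>cosh l * exp (- l * e)\<close> has
  derivative \<open>- e\<close> at 0, hence is below 1 for small \<open>l\<close>.\<close>

lemma AE_lower_bound:
  assumes e: "0 < e"
  shows "AE s in M. \<forall>\<^sub>F t in sequentially. - e * real t \<le> real_of_int (X t s - a)"
proof -
  have "((\<lambda>l. cosh l * exp (- l * e)) has_real_derivative (sinh 0 * exp (- 0 * e) + - e * exp (- 0 * e) * cosh 0)) (at 0)"
    by (auto intro!: derivative_eq_intros)
  then have "((\<lambda>l. cosh l * exp (- l * e)) has_real_derivative - e) (at 0)" by simp
  from DERIV_neg_dec_right[OF this] e obtain d where d: "0 < d" "\<And>h. 0 < h \<Longrightarrow> h < d \<Longrightarrow> cosh h * exp (- h * e) < 1"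
    by auto
  define l where "l = d / 2"
  define r where "r = cosh l * exp (- l * e)"
  have l: "0 < l" and r: "0 \<le> r" "r < 1" using d d(2)[of l] by (auto simp: l_def r_def)
  have [measurable]: "X i \<in> M \<rightarrow>\<^sub>M count_space UNIV" for i by (rule rv)
  define A where "A t = {s \<in> space M. real_of_int (X t s - a) < - e * real t}" for t
  have bd: "prob (A t) \<le> r ^ t" for t
  proof -
    let ?E = "{xs. real_of_int (hd xs - a) < - e * real t}"
    have "A t = {s \<in> space M. history (\<lambda>i. X i s) t \<in> ?E}" by (simp add: A_def hd_history)
    then have "prob (A t) = measure_pmf.prob (cookie_walk p a t) ?E"
      by (simp only: prob_history[OF walk])
    also have "ennreal (exp (l * e * real t)) * ennreal \<dots> = 
        (\<integral>\<^sup>+xs. ennreal (exp (l * e * real t)) * indicator ?E xs \<partial>cookie_walk p a t)"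
      by (simp add: nn_integral_cmult measure_pmf.emeasure_eq_measure)
    also have "\<dots> \<le> (\<integral>\<^sup>+xs. ennreal (exp (- l * real_of_int (hd xs - a))) \<partial>cookie_walk p a t)"
    proof (rule nn_integral_mono)
      fix xs
      show "ennreal (exp (l * e * real t)) * indicator ?E xs \<le> ennreal (exp (- l * real_of_int (hd xs - a)))"
      proof (cases "xs \<in> ?E")
        case True
        then have "l * real_of_int (hd xs - a) \<le> l * (- e * real t)" using l by (intro mult_left_mono) auto
        then have "exp (l * e * real t) \<le> exp (- l * real_of_int (hd xs - a))" by simp
        then show ?thesis using True by (simp add: ennreal_leI)
      qed simp
    qed
    also have "\<dots> \<le> ennreal (cosh l ^ t)" using l by (intro cookie_walk_exp_moment) simp
    finally have "exp (l * e * real t) * prob (A t) \<le> cosh l ^ t"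
      by (simp flip: ennreal_mult)
    then have "exp (- (l * e * real t)) * (exp (l * e * real t) * prob (A t)) \<le> exp (- (l * e * real t)) * cosh l ^ t"
      by (intro mult_left_mono) auto
    moreover have "exp (- (l * e * real t)) * (exp (l * e * real t) * prob (A t)) = prob (A t)"
      by (simp add: exp_minus)
    moreover have "exp (- (l * e * real t)) = exp (- l * e) ^ t"
      by (simp flip: exp_of_nat_mult add: mult_ac)
    ultimately have "prob (A t) \<le> exp (- l * e) ^ t * cosh l ^ t" by (simp only:)
    then show ?thesis unfolding r_def power_mult_distrib by (simp only: mult.commute)
  qed
  have "summable (\<lambda>t. prob (A t))"
    by (rule summable_comparison_test'[of "\<lambda>t. r ^ t" 0]) (use bd r in \<open>auto intro: summable_geometric\<close>)
  then have "AE s in M. \<forall>\<^sub>F t in sequentially. s \<in> space M - A t"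
    by (intro borel_cantelli_AE1) (auto simp: A_def less_top[symmetric])
  then show ?thesis
    by eventually_elim (auto simp: A_def not_less elim!: eventually_mono)
qed

lemma AE_speed_zero:
  assumes "p < 3/4"
  shows "AE s in M. (\<lambda>n. real_of_int (X n s) / real n) \<longlonglongrightarrow> 0"
proof -
  \<comment> \<open>Chosen so that \<open>time_per_site (q j)\<close> is exactly
    \<open>2 * (j + 1)\<close>.\<close>
  define q where "q j = 3/4 + 1 / (8 * (real j + 1))" for j :: nat
  have q: "3/4 < q j" "q j < 1" for j by (auto simp: q_def field_simps)
  have c: "time_per_site (q j) = 2 * (real j + 1)" for j
    by (simp add: time_per_site_def q_def field_simps)
  have "AE s in M. \<forall>\<^sub>F t in sequentially. real_of_int (X t s - a) \<le> 2 / (2 * real j + 1) * real t" for j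
  proof -
    obtain Q D where Q: "0 < Q" and tails: "\<And>i N b. 0 < i \<Longrightarrow> i ^ Q \<le> N \<Longrightarrow>
      measure_pmf.prob (blank_chain (q j) (i ^ Q) b N) {w. real (i ^ Q + 2 * snd w) \<le> (time_per_site (q j) - 1) * real (i ^ Q)}
         \<le> D / 1 * (1 / real i ^ 2)"
      using checkpoint_tails[OF q[of j]] zero_less_one by metis
    have "1 < time_per_site (q j)" by (simp add: c)
    then have "AE s in M. \<forall>\<^sub>F i in sequentially. \<forall>k. real k \<le> (time_per_site (q j) - 1) * real (i ^ Q) \<longrightarrow> X k s \<noteq> a + int (i ^ Q)"
      by (intro AE_not_early[OF q _ Q _ _ tails]) (use assms q[of j] in auto)
    with AE_nn_path[OF walk] show ?thesis
    proof eventually_elim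
      case (elim s)
      then have "\<forall>\<^sub>F t in sequentially. real_of_int (X t s - a) \<le> (1 + 1) / (time_per_site (q j) - 1) * real t"
        using \<open>1 < time_per_site (q j)\<close> Q by (intro speed_upper) auto
      moreover have "(1 + 1) / (time_per_site (q j) - 1) = 2 / (2 * real j + 1)" by (simp add: c)
      ultimately show ?case by (simp only:)
    qed
  qed
  then have "AE s in M. \<forall>j. \<forall>\<^sub>F t in sequentially. real_of_int (X t s - a) \<le> 2 / (2 * real j + 1) * real t"
    by (simp add: AE_all_countable)
  moreover have "AE s in M. \<forall>j. \<forall>\<^sub>F t in sequentially. - (1 / real (Suc j)) * real t \<le> real_of_int (X t s - a)"
    unfolding AE_all_countable by (intro allI AE_lower_bound) simp
  ultimately show ?thesis
    using AE_nn_path[OF walk]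
  proof eventually_elim
    case (elim s)
    show ?case
    proof (rule tendsto_speed[of "\<lambda>t. X t s" a])
      fix e :: real assume e: "0 < e"
      then obtain j where j: "1 / real (Suc j) < e" using reals_Archimedean by (auto simp: inverse_eq_divide)
      from elim(2) have "\<forall>\<^sub>F t in sequentially. - (1 / real (Suc j)) * real t \<le> real_of_int (X t s - a)" by blast
      then show "\<forall>\<^sub>F t in sequentially. (0 - e) * real t \<le> real_of_int (X t s - a)"
      proof eventually_elim
        case (elim t)
        have "(0 - e) * real t \<le> - (1 / real (Suc j)) * real t" using j by (intro mult_right_mono) auto
        then show ?case using elim by linarith
      qed
      \<comment> \<open>The index \<open>2 * Suc j\<close> brings the slope below
        \<open>1 / Suc j\<close>, hence below \<open>e\<close>.\<close>
      from elim(1) have "\<forall>\<^sub>F t in sequentially. real_of_int (X t s - a) \<le> 2 / (2 * real (2 * Suc j) + 1) * real t" by blast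
      then show "\<forall>\<^sub>F t in sequentially. real_of_int (X t s - a) \<le> (0 + e) * real t"
      proof eventually_elim
        case (elim t)
        have "2 / (2 * real (2 * Suc j) + 1) \<le> 1 / real (Suc j)" by (simp add: field_simps)
        then have "2 / (2 * real (2 * Suc j) + 1) * real t \<le> (0 + e) * real t" using j by (intro mult_right_mono) auto
        then show ?case using elim by linarith
      qed
    qed (use elim in auto)
  qed
qed

lemma AE_speed_positive:
  assumes p: "3/4 < p"
  shows "AE s in M. (\<lambda>n. real_of_int (X n s) / real n) \<longlonglongrightarrow> 4 * p - 3"
proof -
  define c where "c = time_per_site p"
  have c: "1 \<le> c" "1 / c = 4 * p - 3" using p p_bounds by (auto simp: c_def time_per_site_def field_simps)
  \<comment> \<open>Countably many tolerances, so that one null set serves all; each is below 1 and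
    hence below \<open>c\<close>.\<close>
  define \<epsilon> where "\<epsilon> j = 1 / real (Suc (Suc j))" for j
  have \<epsilon>: "0 < \<epsilon> j" "\<epsilon> j < c" for j 
  proof -
    have "\<epsilon> j < 1" by (simp add: \<epsilon>_def)
    then show "\<epsilon> j < c" using c by linarith
  qed (simp add: \<epsilon>_def)
  have \<epsilon>0: "\<epsilon> \<longlonglongrightarrow> 0"
    unfolding \<epsilon>_def by real_asymp
  have up: "(\<lambda>j. (1 + \<epsilon> j) / (c - \<epsilon> j)) \<longlonglongrightarrow> (1 + 0) / (c - 0)"
    using c by (intro tendsto_intros \<epsilon>0) auto
  have lo: "(\<lambda>j. 1 - (c + \<epsilon> j - 1) * (1 + \<epsilon> j) / (c - \<epsilon> j)) \<longlonglongrightarrow> 1 - (c + 0 - 1) * (1 + 0) / (c - 0)"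
    using c by (intro tendsto_intros \<epsilon>0) auto
  have lo_lim: "1 - (c + 0 - 1) * (1 + 0) / (c - 0) = 4 * p - 3" and up_lim: "(1 + 0) / (c - 0) = 4 * p - 3"
    using c by (auto simp: field_simps)
  obtain Q D where Q: "0 < Q" and 
    early: "\<And>i N b e. 0 < i \<Longrightarrow> i ^ Q \<le> N \<Longrightarrow> 0 < e \<Longrightarrow>
      measure_pmf.prob (blank_chain p (i ^ Q) b N) {w. real (i ^ Q + 2 * snd w) \<le> (time_per_site p - e) * real (i ^ Q)}
         \<le> D / e * (1 / real i ^ 2)" and
    late: "\<And>i N b e. 0 < i \<Longrightarrow> i ^ Q \<le> N \<Longrightarrow> 0 < e \<Longrightarrow>
      measure_pmf.prob (blank_chain p (i ^ Q) b N) {w. real (i ^ Q + 2 * snd w) \<ge> (time_per_site p + e) * real (i ^ Q)}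
         \<le> D / e * (1 / real i ^ 2)"
    using checkpoint_tails[OF p p_bounds(2)] by metis
  have "AE s in M. \<forall>j. \<forall>\<^sub>F i in sequentially. \<forall>k. real k \<le> (c - \<epsilon> j) * real (i ^ Q) \<longrightarrow> X k s \<noteq> a + int (i ^ Q)"
    unfolding AE_all_countable c_def
  proof
    fix j
    show "AE s in M. \<forall>\<^sub>F i in sequentially. \<forall>k. real k \<le> (time_per_site p - \<epsilon> j) * real (i ^ Q) \<longrightarrow> X k s \<noteq> a + int (i ^ Q)"
      using \<epsilon>(2)[of j] unfolding c_def
      by (intro AE_not_early[OF p p_bounds(2) order_refl Q \<epsilon>(1) _ early[OF _ _ \<epsilon>(1)]])
  qed
  moreover have "AE s in M. \<forall>j. \<forall>\<^sub>F i in sequentially. \<exists>k. real k \<le> (c + \<epsilon> j) * real (i ^ Q) \<and> X k s = a + int (i ^ Q)"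
    unfolding AE_all_countable c_def
    by (intro allI AE_hit_in_time[OF p Q \<epsilon>(1) late[OF _ _ \<epsilon>(1)]])
  ultimately show ?thesis
    using AE_nn_path[OF walk]
  proof eventually_elim
    case (elim s)
    then have x0: "X 0 s = a" and nn: "\<And>t. \<bar>X (Suc t) s - X t s\<bar> = 1" by auto
    show ?case
    proof (rule tendsto_speed[of "\<lambda>t. X t s" a, OF x0 nn Q])
      fix e :: real assume e: "0 < e"
      have "\<forall>\<^sub>F j in sequentially. 4 * p - 3 - e < 1 - (c + \<epsilon> j - 1) * (1 + \<epsilon> j) / (c - \<epsilon> j)"
        using lo e unfolding lo_lim by (intro order_tendstoD(1)) auto
      then obtain j where j: "4 * p - 3 - e < 1 - (c + \<epsilon> j - 1) * (1 + \<epsilon> j) / (c - \<epsilon> j)"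
        using eventually_happens'[OF sequentially_bot] by blast
      have "\<forall>\<^sub>F t in sequentially. (1 - (c + \<epsilon> j - 1) * (1 + \<epsilon> j) / (c - \<epsilon> j)) * real t \<le> real_of_int (X t s - a)"
        using elim by (intro speed_lower[OF x0 nn Q \<epsilon> c(1)]) auto
      then show "\<forall>\<^sub>F t in sequentially. (4 * p - 3 - e) * real t \<le> real_of_int (X t s - a)"
      proof eventually_elim
        case (elim t)
        have "(4 * p - 3 - e) * real t \<le> (1 - (c + \<epsilon> j - 1) * (1 + \<epsilon> j) / (c - \<epsilon> j)) * real t"
          using j by (intro mult_right_mono) auto
        then show ?case using elim by linarith
      qed
    next
      fix e :: real assume e: "0 < e"
      have "\<forall>\<^sub>F j in sequentially. (1 + \<epsilon> j) / (c - \<epsilon> j) < 4 * p - 3 + e"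
        using up e unfolding up_lim by (intro order_tendstoD(2)) auto
      then obtain j where j: "(1 + \<epsilon> j) / (c - \<epsilon> j) < 4 * p - 3 + e"
        using eventually_happens'[OF sequentially_bot] by blast
      have "\<forall>\<^sub>F t in sequentially. real_of_int (X t s - a) \<le> (1 + \<epsilon> j) / (c - \<epsilon> j) * real t"
        using elim by (intro speed_upper[OF x0 nn Q \<epsilon>]) auto
      then show "\<forall>\<^sub>F t in sequentially. real_of_int (X t s - a) \<le> (4 * p - 3 + e) * real t"
      proof eventually_elim
        case (elim t)
        have "(1 + \<epsilon> j) / (c - \<epsilon> j) * real t \<le> (4 * p - 3 + e) * real t"
          using j by (intro mult_right_mono) auto
        then show ?case using elim by linarith
      qed
    qed
  qed
qed

end

theorem theorem3:
  fixes M :: "'a measure" and p :: real and x0 :: int and X :: "nat \<Rightarrow> 'a \<Rightarrow> int"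
  assumes "p \<in> {1/2..<1}"
    and "cookie_random_walk M (\<lambda>_. p) x0 X"
  shows "(p < 3/4 \<longrightarrow> (AE s in M. (\<lambda>n. real_of_int (X n s) / real n) \<longlonglongrightarrow> 0)) \<and>
    (p > 3/4 \<longrightarrow> (AE s in M. \<exists>v. (\<lambda>n. real_of_int (X n s) / real n) \<longlonglongrightarrow> v \<and>
      v > 0 \<and> v \<ge> 4 * p - 3 \<and> (10/11 \<le> p \<longrightarrow> v = 4 * p - 3)))"
proof (intro conjI impI)
  assume "p < 3/4"
  then show "AE s in M. (\<lambda>n. real_of_int (X n s) / real n) \<longlonglongrightarrow> 0"
    by (rule AE_speed_zero[OF assms(2)])
next
  assume p: "p > 3/4"
  from AE_speed_positive[OF assms(2) p]
  show "AE s in M. \<exists>v. (\<lambda>n. real_of_int (X n s) / real n) \<longlonglongrightarrow> v \<and>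
      v > 0 \<and> v \<ge> 4 * p - 3 \<and> (10/11 \<le> p \<longrightarrow> v = 4 * p - 3)"
    by eventually_elim (use p in auto)
qed

end
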